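(* Let $(M,g)$ be a Riemannian manifold of dimension $n\geq 3$ and let $G$ be a pseudo-Riemannian $g$-natural metric on $TM$ whose defining functions $\alpha_i,\beta_i$ ($i=1,2,3$) satisfy $\alpha_1(0)(\alpha_1+\alpha_3)(0)-2\alpha_2^2(0)\neq 0$. Let $Z$ be a vector field on $TM$ and $\bar\lambda\in\mathbb{R}$. If $(TM,G,Z,\bar\lambda)$ is a Ricci soliton, then $(M,g,Z_0,\lambda)$ is a Ricci soliton, where, for $x\in M$, $$Z_0(x)=\frac{\alpha(0)}{[\alpha_1(\alpha_1+\alpha_3)-2\alpha_2^2](0)}\left\{(\alpha_1+\alpha_3)(0)\,d\pi(Z(x,0))+\alpha_2(0)\,K(Z(x,0))\right\},$$ $$\lambda=\frac{(\alpha_1+\alpha_3)\left[\bar\lambda\,\alpha+\beta_1+\beta_3+n(\alpha_1+\alpha_3)'\right]}{\alpha_1(\alpha_1+\alpha_3)-2\alpha_2^2}(0),$$ $\pi:TM\to M$ is the natural projection and $K:TTM\to TM$ is the connection map of the Levi-Civita connection of $(M,g)$.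
   Context: Ricci soliton: $(N,h,V,\lambda)$ is a Ricci soliton if $h$ is a pseudo-Riemannian metric on the smooth manifold $N$, $V$ is a vector field on $N$, $\lambda\in\mathbb{R}$, and $\mathrm{Ric}+\frac12\mathcal{L}_Vh=\lambda h$, where $\mathrm{Ric}$ is the Ricci tensor of $h$. Lifts: Let $\nabla$ be the Levi-Civita connection of $(M,g)$ and $M_x=T_xM$. At $(x,u)\in TM$ the tangent space of $TM$ splits as the direct sum of the horizontal space (with respect to $\nabla$) and the vertical space. For $X\in M_x$, $X^h$ is the unique horizontal vector at $(x,u)$ projecting to $X$, and $X^v$ is the vertical vector at $(x,u)$ with $X^v(df)=Xf$ for all functions $f$ on $M$ (with $df$ viewed as the function $(x,u)\mapsto uf$ on $TM$). In induced coordinates $(x^i,u^i)$: $X^h=X^i\partial_{x^i}-\Gamma^i_{jk}u^jX^k\partial_{u^i}$ and $X^v=X^i\partial_{u^i}$. The connection map $K$ is characterized by being fiberwise linear with $K(X^h)=0$ and $K(X^v)=X$. $(x,0)$ denotes the zero vector of $M_x$. $g$-natural metric: a $g$-natural metric $G$ on $TM$ is one for which there are six smooth functions $\alpha_i,\beta_i:\mathbb{R}^+=[0,\infty)\to\mathbb{R}$, $i=1,2,3$, such that for all $u,X,Y\in M_x$, with $r^2=g_x(u,u)$, $$G_{(x,u)}(X^h,Y^h)=(\alpha_1+\alpha_3)(r^2)g_x(X,Y)+(\beta_1+\beta_3)(r^2)g_x(X,u)g_x(Y,u),$$ $$G_{(x,u)}(X^h,Y^v)=G_{(x,u)}(X^v,Y^h)=\alpha_2(r^2)g_x(X,Y)+\beta_2(r^2)g_x(X,u)g_x(Y,u),$$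 $$G_{(x,u)}(X^v,Y^v)=\alpha_1(r^2)g_x(X,Y)+\beta_1(r^2)g_x(X,u)g_x(Y,u).$$ Put $\phi_i(t)=\alpha_i(t)+t\beta_i(t)$, $\alpha(t)=\alpha_1(t)(\alpha_1+\alpha_3)(t)-\alpha_2^2(t)$, $\phi(t)=\phi_1(t)(\phi_1+\phi_3)(t)-\phi_2^2(t)$. $G$ is non-degenerate (pseudo-Riemannian) if and only if $\alpha(t)\neq0$ and $\phi(t)\neq0$ for all $t\in\mathbb{R}^+$. A prime denotes the derivative with respect to $t$. *)

theory Defs
  imports "HOL-Analysis.Analysis"
begin

section \<open>Smooth functions\<close>

text \<open>For an open subset of a Euclidean space, this is k-fold continuous differentiability.\<close>

primrec C_on :: "nat \<Rightarrow> 'a::euclidean_space set \<Rightarrow> ('a \<Rightarrow> 'b::real_normed_vector) \<Rightarrow> bool" where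
  "C_on 0 S f \<longleftrightarrow> continuous_on S f"
| "C_on (Suc k) S f \<longleftrightarrow> (\<forall>x\<in>S. f differentiable (at x)) \<and>
     (\<forall>v. C_on k S (\<lambda>x. frechet_derivative f (at x) v))"

definition smooth_on :: "'a::euclidean_space set \<Rightarrow> ('a \<Rightarrow> 'b::real_normed_vector) \<Rightarrow> bool" where
  "smooth_on S f \<longleftrightarrow> (\<forall>k. C_on k S f)"

text \<open>Smoothness on the closed half-line, in the usual sense for a closed set: the function is
  the restriction of a smooth function on the line. The values at negative arguments are
  irrelevant.\<close>

definition smooth_half_line :: "(real \<Rightarrow> real) \<Rightarrow> bool" where
  "smooth_half_line f \<longleftrightarrow> (\<exists>F. smooth_on UNIV F \<and> (\<forall>t\<ge>0. f t = F t))"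

abbreviation half_line_deriv :: "(real \<Rightarrow> real) \<Rightarrow> real \<Rightarrow> real" where
  "half_line_deriv f t \<equiv> vector_derivative f (at t within {0..})"

abbreviation dir_deriv ::
    "('a::euclidean_space \<Rightarrow> 'b::real_normed_vector) \<Rightarrow> 'a \<Rightarrow> 'a \<Rightarrow> 'b" where
  "dir_deriv f y v \<equiv> frechet_derivative f (at y) v"

section \<open>Manifolds\<close>

text \<open>A manifold is given by a smooth atlas on the set of its points; the dimension is that of
  the Euclidean space the charts map to. A chart is a pair of its domain and its coordinate map,
  whose values outside the domain are irrelevant. The topology is the one induced by the atlas.\<close>

type_synonym ('m, 'e) chart = "'m set \<times> ('m \<Rightarrow> 'e)"

definition dom_of :: "('m, 'e) chart \<Rightarrow> 'm set" where
  "dom_of c = fst c"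

definition coord :: "('m, 'e) chart \<Rightarrow> 'm \<Rightarrow> 'e" where
  "coord c = snd c"

definition point_at :: "('m, 'e) chart \<Rightarrow> 'e \<Rightarrow> 'm" where
  "point_at c = inv_into (dom_of c) (coord c)"

definition img_of :: "('m, 'e) chart \<Rightarrow> 'e set" where
  "img_of c = coord c ` dom_of c"

definition trans_map :: "('m, 'e) chart \<Rightarrow> ('m, 'e) chart \<Rightarrow> 'e \<Rightarrow> 'e" where
  "trans_map c c' = coord c' \<circ> point_at c"

definition points :: "('m, 'e) chart set \<Rightarrow> 'm set" where
  "points A = (\<Union>c\<in>A. dom_of c)"

definition smooth_atlas :: "('m, 'e::euclidean_space) chart set \<Rightarrow> bool" where
  "smooth_atlas A \<longleftrightarrow>
     (\<forall>c\<in>A. inj_on (coord c) (dom_of c) \<and> open (img_of c)) \<and>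
     (\<forall>c\<in>A. \<forall>c'\<in>A. open (coord c ` (dom_of c \<inter> dom_of c')) \<and>
        smooth_on (coord c ` (dom_of c \<inter> dom_of c')) (trans_map c c'))"

definition atlas_open :: "('m, 'e::euclidean_space) chart set \<Rightarrow> 'm set \<Rightarrow> bool" where
  "atlas_open A W \<longleftrightarrow> W \<subseteq> points A \<and> (\<forall>c\<in>A. open (coord c ` (W \<inter> dom_of c)))"

definition manifold_topology :: "('m, 'e::euclidean_space) chart set \<Rightarrow> 'm topology" where
  "manifold_topology A = topology (atlas_open A)"

lemma openin_manifold_topology:
  assumes "smooth_atlas A"
  shows "openin (manifold_topology A) = atlas_open A"
proof -
  have "istopology (atlas_open A)"
    unfolding istopology_def
  proof (intro conjI allI impI)
    fix S T assume ST: "atlas_open A S" "atlas_open A T"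
    have "open (coord c ` (S \<inter> T \<inter> dom_of c))" if "c \<in> A" for c
    proof -
      have "inj_on (coord c) (dom_of c)"
        using assms that by (simp add: smooth_atlas_def)
      then have "coord c ` (S \<inter> T \<inter> dom_of c) =
          coord c ` (S \<inter> dom_of c) \<inter> coord c ` (T \<inter> dom_of c)"
        by (auto simp: inj_on_def)
      then show ?thesis
        using ST that by (simp add: atlas_open_def open_Int)
    qed
    then show "atlas_open A (S \<inter> T)"
      using ST by (auto simp: atlas_open_def)
  next
    fix \<K> assume K: "\<forall>K\<in>\<K>. atlas_open A K"
    have "open (coord c ` (\<Union>\<K> \<inter> dom_of c))" if "c \<in> A" for c
    proof -
      have "coord c ` (\<Union>\<K> \<inter> dom_of c) = (\<Union>K\<in>\<K>. coord c ` (K \<inter> dom_of c))"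
        by auto
      then show ?thesis
        using K that by (auto simp: atlas_open_def)
    qed
    then show "atlas_open A (\<Union>\<K>)"
      using K by (auto simp: atlas_open_def)
  qed
  then show ?thesis
    by (simp add: manifold_topology_def)
qed

definition smooth_manifold :: "('m, 'e::euclidean_space) chart set \<Rightarrow> bool" where
  "smooth_manifold A \<longleftrightarrow> smooth_atlas A \<and>
     Hausdorff_space (manifold_topology A) \<and>
     (\<exists>\<B>. countable \<B> \<and> (\<forall>B\<in>\<B>. openin (manifold_topology A) B) \<and>
        (\<forall>W. openin (manifold_topology A) W \<longrightarrow> (\<exists>\<U>\<subseteq>\<B>. W = \<Union>\<U>)))"

section \<open>Tangent vectors and tensor fields\<close>

text \<open>A tangent vector at a point is the family of its components in the charts around that
  point, subject to the usual transformation rule (and extended by 0 to the other charts, so that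
  the vector space operations are the pointwise ones).\<close>

type_synonym ('m, 'e) tvec = "('m, 'e) chart \<Rightarrow> 'e"

type_synonym ('m, 'e) vfield = "'m \<Rightarrow> ('m, 'e) tvec"

type_synonym ('m, 'e) bilinear_field = "'m \<Rightarrow> ('m, 'e) tvec \<Rightarrow> ('m, 'e) tvec \<Rightarrow> real"

definition charts_at :: "('m, 'e) chart set \<Rightarrow> 'm \<Rightarrow> ('m, 'e) chart set" where
  "charts_at A x = {c \<in> A. x \<in> dom_of c}"

definition tangent_space :: "('m, 'e::euclidean_space) chart set \<Rightarrow> 'm \<Rightarrow> ('m, 'e) tvec set" where
  "tangent_space A x = {u. (\<forall>c. c \<notin> charts_at A x \<longrightarrow> u c = 0) \<and>
     (\<forall>c\<in>charts_at A x. \<forall>c'\<in>charts_at A x. u c' = dir_deriv (trans_map c c') (coord c x) (u c))}"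

text \<open>The tangent vector at x with components w in the chart c.\<close>

definition tvec_of ::
    "('m, 'e::euclidean_space) chart set \<Rightarrow> ('m, 'e) chart \<Rightarrow> 'm \<Rightarrow> 'e \<Rightarrow> ('m, 'e) tvec" where
  "tvec_of A c x w =
     (\<lambda>c'. if c' \<in> charts_at A x then dir_deriv (trans_map c c') (coord c x) w else 0)"

text \<open>Coordinate expressions in a chart, as functions of the coordinates.\<close>

definition vfield_rep :: "('m, 'e) chart \<Rightarrow> ('m, 'e) vfield \<Rightarrow> 'e \<Rightarrow> 'e" where
  "vfield_rep c V y = V (point_at c y) c"

definition form_rep :: "('m, 'e::euclidean_space) chart set \<Rightarrow> ('m, 'e) chart \<Rightarrow>
    ('m, 'e) bilinear_field \<Rightarrow> 'e \<Rightarrow> 'e \<Rightarrow> 'e \<Rightarrow> real" where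
  "form_rep A c h y X Y =
     h (point_at c y) (tvec_of A c (point_at c y) X) (tvec_of A c (point_at c y) Y)"

definition vector_field :: "('m, 'e::euclidean_space) chart set \<Rightarrow> ('m, 'e) vfield \<Rightarrow> bool" where
  "vector_field A V \<longleftrightarrow> (\<forall>x\<in>points A. V x \<in> tangent_space A x) \<and>
     (\<forall>c\<in>A. smooth_on (img_of c) (vfield_rep c V))"

definition symmetric_form_field ::
    "('m, 'e::euclidean_space) chart set \<Rightarrow> ('m, 'e) bilinear_field \<Rightarrow> bool" where
  "symmetric_form_field A h \<longleftrightarrow>
     (\<forall>x\<in>points A. \<forall>u\<in>tangent_space A x. \<forall>v\<in>tangent_space A x.
        h x u v = h x v u \<and>
        (\<forall>w\<in>tangent_space A x. \<forall>a. h x (\<lambda>c. a *\<^sub>R u c + v c) w = a * h x u w + h x v w)) \<and>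
     (\<forall>c\<in>A. \<forall>X Y. smooth_on (img_of c) (\<lambda>y. form_rep A c h y X Y))"

definition pseudo_riemannian_metric ::
    "('m, 'e::euclidean_space) chart set \<Rightarrow> ('m, 'e) bilinear_field \<Rightarrow> bool" where
  "pseudo_riemannian_metric A h \<longleftrightarrow> symmetric_form_field A h \<and>
     (\<forall>x\<in>points A. \<forall>u\<in>tangent_space A x.
        (\<forall>v\<in>tangent_space A x. h x u v = 0) \<longrightarrow> u = (\<lambda>c. 0))"

definition riemannian_metric ::
    "('m, 'e::euclidean_space) chart set \<Rightarrow> ('m, 'e) bilinear_field \<Rightarrow> bool" where
  "riemannian_metric A h \<longleftrightarrow> symmetric_form_field A h \<and>
     (\<forall>x\<in>points A. \<forall>u\<in>tangent_space A x. u \<noteq> (\<lambda>c. 0) \<longrightarrow> h x u u > 0)"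

section \<open>Levi-Civita connection, Ricci tensor and Ricci solitons\<close>

text \<open>In the following definitions, h is the coordinate expression of a metric on an open set of
  the model space, and X, Y, Z, viewed as constant vector fields on that set, commute.
  The Christoffel map is the covariant derivative of Y along X for the Levi-Civita connection,
  determined by the Koszul formula.\<close>

definition christoffel :: "('e \<Rightarrow> 'e \<Rightarrow> 'e \<Rightarrow> real) \<Rightarrow> 'e \<Rightarrow> 'e \<Rightarrow> 'e \<Rightarrow> 'e::euclidean_space" where
  "christoffel h y X Y = (THE W. \<forall>Z. 2 * h y W Z =
     dir_deriv (\<lambda>y. h y Y Z) y X + dir_deriv (\<lambda>y. h y X Z) y Y - dir_deriv (\<lambda>y. h y X Y) y Z)"

text \<open>The curvature convention is R(X,Y)Z = D_X D_Y Z - D_Y D_X Z - D_[X,Y] Z.\<close>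

definition curvature ::
    "('e \<Rightarrow> 'e \<Rightarrow> 'e \<Rightarrow> real) \<Rightarrow> 'e \<Rightarrow> 'e \<Rightarrow> 'e \<Rightarrow> 'e \<Rightarrow> 'e::euclidean_space" where
  "curvature h y X Y Z =
     dir_deriv (\<lambda>y. christoffel h y Y Z) y X - dir_deriv (\<lambda>y. christoffel h y X Z) y Y +
     christoffel h y X (christoffel h y Y Z) - christoffel h y Y (christoffel h y X Z)"

text \<open>Ric(Y,Z) is the trace of the endomorphism mapping X to R(X,Y)Z.\<close>

definition ricci :: "('e::euclidean_space \<Rightarrow> 'e \<Rightarrow> 'e \<Rightarrow> real) \<Rightarrow> 'e \<Rightarrow> 'e \<Rightarrow> 'e \<Rightarrow> real" where
  "ricci h y Y Z = (\<Sum>b\<in>Basis. curvature h y b Y Z \<bullet> b)"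

text \<open>(L_V h)(X,Y) = V(h(X,Y)) - h([V,X],Y) - h(X,[V,Y]); here [V,X] is minus the derivative of V
  in the direction X, since X is constant.\<close>

definition lie_derivative ::
    "('e::euclidean_space \<Rightarrow> 'e) \<Rightarrow> ('e \<Rightarrow> 'e \<Rightarrow> 'e \<Rightarrow> real) \<Rightarrow> 'e \<Rightarrow> 'e \<Rightarrow> 'e \<Rightarrow> real" where
  "lie_derivative V h y X Y =
     dir_deriv (\<lambda>y. h y X Y) y (V y) + h y (dir_deriv V y X) Y + h y X (dir_deriv V y Y)"

text \<open>The soliton equation is required in all charts. That A is the atlas of a smooth manifold is a
  standing assumption here, as in the definitions of tensor fields above.\<close>

definition ricci_soliton :: "('m, 'e::euclidean_space) chart set \<Rightarrow> ('m, 'e) bilinear_field \<Rightarrow>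
    ('m, 'e) vfield \<Rightarrow> real \<Rightarrow> bool" where
  "ricci_soliton A h V k \<longleftrightarrow> pseudo_riemannian_metric A h \<and> vector_field A V \<and>
     (\<forall>c\<in>A. \<forall>y\<in>img_of c. \<forall>X Y.
        ricci (form_rep A c h) y X Y
          + 1 / 2 * lie_derivative (vfield_rep c V) (form_rep A c h) y X Y
        = k * form_rep A c h y X Y)"

section \<open>The tangent bundle\<close>

type_synonym ('m, 'e) tpoint = "'m \<times> ('m, 'e) tvec"

text \<open>The chart of the tangent bundle induced by a chart of the base: the coordinates of (x, u)
  are those of x followed by the components of u.\<close>

definition tangent_chart :: "('m, 'e::euclidean_space) chart set \<Rightarrow> ('m, 'e) chart \<Rightarrow>
    (('m, 'e) tpoint, 'e \<times> 'e) chart" where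
  "tangent_chart A c =
     ({(x, u). x \<in> dom_of c \<and> u \<in> tangent_space A x}, \<lambda>(x, u). (coord c x, u c))"

definition tangent_atlas ::
    "('m, 'e::euclidean_space) chart set \<Rightarrow> (('m, 'e) tpoint, 'e \<times> 'e) chart set" where
  "tangent_atlas A = tangent_chart A ` A"

definition zero_vector :: "'m \<Rightarrow> ('m, 'e::euclidean_space) tpoint" where
  "zero_vector x = (x, \<lambda>c. 0)"

text \<open>The differential of the projection of the tangent bundle, which is the first projection in
  induced coordinates.\<close>

definition dproj :: "('m, 'e::euclidean_space) chart set \<Rightarrow> ('m, 'e) tpoint \<Rightarrow>
    (('m, 'e) tpoint, 'e \<times> 'e) tvec \<Rightarrow> ('m, 'e) tvec" where
  "dproj A p \<xi> = (\<lambda>c. if c \<in> charts_at A (fst p) then fst (\<xi> (tangent_chart A c)) else 0)"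

definition horizontal_lift :: "('m, 'e::euclidean_space) chart set \<Rightarrow> ('m, 'e) bilinear_field \<Rightarrow>
    ('m, 'e) tpoint \<Rightarrow> ('m, 'e) tvec \<Rightarrow> (('m, 'e) tpoint, 'e \<times> 'e) tvec" where
  "horizontal_lift A g p X = (case p of (x, u) \<Rightarrow>
     (THE \<xi>. \<xi> \<in> tangent_space (tangent_atlas A) p \<and>
        (\<forall>c\<in>charts_at A x. \<xi> (tangent_chart A c) =
           (X c, - christoffel (form_rep A c g) (coord c x) (u c) (X c)))))"

definition vertical_lift :: "('m, 'e::euclidean_space) chart set \<Rightarrow>
    ('m, 'e) tpoint \<Rightarrow> ('m, 'e) tvec \<Rightarrow> (('m, 'e) tpoint, 'e \<times> 'e) tvec" where
  "vertical_lift A p X =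
     (THE \<xi>. \<xi> \<in> tangent_space (tangent_atlas A) p \<and>
        (\<forall>c\<in>charts_at A (fst p). \<xi> (tangent_chart A c) = (0, X c)))"

text \<open>The linear map which vanishes on horizontal lifts and maps the vertical lift of X to X,
  in induced coordinates.\<close>

definition connection_map :: "('m, 'e::euclidean_space) chart set \<Rightarrow> ('m, 'e) bilinear_field \<Rightarrow>
    ('m, 'e) tpoint \<Rightarrow> (('m, 'e) tpoint, 'e \<times> 'e) tvec \<Rightarrow> ('m, 'e) tvec" where
  "connection_map A g p \<xi> = (case p of (x, u) \<Rightarrow>
     (\<lambda>c. if c \<in> charts_at A x
        then snd (\<xi> (tangent_chart A c)) +
          christoffel (form_rep A c g) (coord c x) (u c) (fst (\<xi> (tangent_chart A c)))
        else 0))"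

section \<open>Natural metrics\<close>

definition g_natural_metric :: "('m, 'e::euclidean_space) chart set \<Rightarrow> ('m, 'e) bilinear_field \<Rightarrow>
    (('m, 'e) tpoint, 'e \<times> 'e) bilinear_field \<Rightarrow>
    (real \<Rightarrow> real) \<Rightarrow> (real \<Rightarrow> real) \<Rightarrow> (real \<Rightarrow> real) \<Rightarrow>
    (real \<Rightarrow> real) \<Rightarrow> (real \<Rightarrow> real) \<Rightarrow> (real \<Rightarrow> real) \<Rightarrow> bool" where
  "g_natural_metric A g G \<alpha>\<^sub>1 \<alpha>\<^sub>2 \<alpha>\<^sub>3 \<beta>\<^sub>1 \<beta>\<^sub>2 \<beta>\<^sub>3 \<longleftrightarrow>
     (\<forall>f\<in>{\<alpha>\<^sub>1, \<alpha>\<^sub>2, \<alpha>\<^sub>3, \<beta>\<^sub>1, \<beta>\<^sub>2, \<beta>\<^sub>3}. smooth_half_line f) \<and>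
     (\<forall>x\<in>points A. \<forall>u\<in>tangent_space A x. \<forall>X\<in>tangent_space A x. \<forall>Y\<in>tangent_space A x.
       let p = (x, u); t = g x u u;
           Xh = horizontal_lift A g p X; Yh = horizontal_lift A g p Y;
           Xv = vertical_lift A p X; Yv = vertical_lift A p Y
       in G p Xh Yh = (\<alpha>\<^sub>1 t + \<alpha>\<^sub>3 t) * g x X Y + (\<beta>\<^sub>1 t + \<beta>\<^sub>3 t) * g x X u * g x Y u \<and>
          G p Xh Yv = \<alpha>\<^sub>2 t * g x X Y + \<beta>\<^sub>2 t * g x X u * g x Y u \<and>
          G p Xv Yh = \<alpha>\<^sub>2 t * g x X Y + \<beta>\<^sub>2 t * g x X u * g x Y u \<and>
          G p Xv Yv = \<alpha>\<^sub>1 t * g x X Y + \<beta>\<^sub>1 t * g x X u * g x Y u)"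

definition alpha_fun ::
    "(real \<Rightarrow> real) \<Rightarrow> (real \<Rightarrow> real) \<Rightarrow> (real \<Rightarrow> real) \<Rightarrow> real \<Rightarrow> real" where
  "alpha_fun \<alpha>\<^sub>1 \<alpha>\<^sub>2 \<alpha>\<^sub>3 t = \<alpha>\<^sub>1 t * (\<alpha>\<^sub>1 t + \<alpha>\<^sub>3 t) - (\<alpha>\<^sub>2 t)\<^sup>2"

end

theory Submission
  imports Defs
begin

text \<open>The only component of the soliton equation on the tangent bundle that is used is the one for two
horizontal lifts, and it is used only at zero vectors. Write \<open>a = \<alpha>\<^sub>1 + \<alpha>\<^sub>3\<close>, \<open>b = \<alpha>\<^sub>2\<close>, \<open>c = \<alpha>\<^sub>1\<close>
and \<open>p = \<beta>\<^sub>1 + \<beta>\<^sub>3\<close>, put \<open>\<alpha> = a c - b\<^sup>2\<close>, \<open>D = a c - 2 b\<^sup>2\<close> (all at 0), and let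
\<open>n\<close> be the dimension of the base.

At the zero vector the horizontal component of the Lie derivative of \<open>G\<close> along \<open>Z\<close> is the Lie
derivative of \<open>g\<close> along \<open>a d\<pi>(Z) + b K(Z)\<close>, a vector field on the base
(\<open>lie_derivative_zero_section\<close>): in induced coordinates \<open>G((Y,0),(Z,0))\<close> and its first derivatives along
the zero section are combinations of \<open>g\<close> and its first derivatives with the coefficients \<open>a\<close>, \<open>b\<close>.
The Ricci tensor satisfies
\<open>\<alpha> Ric\<^sub>G(Y\<^sup>h, Z\<^sup>h) = D Ric\<^sub>g(Y, Z) - a (n a' + p) g(Y, Z)\<close> (\<open>ricci_zero_section\<close>). Since \<open>D \<noteq> 0\<close>, the equation
of the soliton on \<open>TM\<close>, multiplied by \<open>\<alpha> / D\<close>, becomes the equation of a soliton on \<open>M\<close>, with the vector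
field and the constant of the theorem.

The formula for the Ricci tensor is obtained in an arbitrary chart, with no normal coordinates.
Comparing first derivatives shows that at zero vectors the Levi-Civita connection of \<open>G\<close> is
\<open>((X,W),(Y,V)) \<mapsto> (\<Gamma>(X,Y), \<Gamma>(X,V) + \<Gamma>(W,Y))\<close> (\<open>christoffel_zero_section\<close>), for every natural metric.
The trace that defines \<open>Ric\<^sub>G\<close> splits into a horizontal part, which is \<open>Ric\<^sub>g\<close> because horizontal curvature
only involves derivatives along the zero section, and a vertical part. In the vertical part one new
quantity appears, the derivative in a fibre direction \<open>W\<close> of the Christoffel map of \<open>G\<close> at the constant
fields \<open>(Y,0)\<close> and \<open>(Z,0)\<close>. It is found by differentiating the Koszul formula of \<open>G\<close> in the direction
\<open>W\<close>: as partial derivatives commute, this only needs the first derivative of \<open>G\<close> in fibre directions along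
the zero section, and the Hessian in the fibre variable of the coefficient \<open>G((Y,0),(Z,0))\<close>, the place
where \<open>a'\<close> and \<open>p\<close> enter. The result
(\<open>curvature_vertical_eq\<close>) is a multiple of \<open>R(W,Y)Z\<close>, whose trace is the Ricci tensor, plus a multiple of
\<open>R(Z,Y)W\<close>, whose trace over \<open>W\<close> vanishes as curvature is skew, plus explicit terms in \<open>g\<close>.

The passage between charts and the bundle rests on the transformation law of the Christoffel symbols:
it shows that horizontal lifts exist as tangent vectors of the tangent bundle, and hence that \<open>G\<close> has
the expected expression in every induced chart (\<open>natural_metric_in_induced_chart\<close>).\<close>

section \<open>Directional derivatives and smooth functions\<close>

lemma has_derivative_dir_deriv:
  "f differentiable (at x) \<Longrightarrow> (f has_derivative dir_deriv f x) (at x)"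
  by (simp add: frechet_derivative_works)

lemma dir_deriv_eqI: "(f has_derivative f') (at x) \<Longrightarrow> dir_deriv f x v = f' v"
  by (simp add: frechet_derivative_at[symmetric])

lemma dir_deriv_cong_open:
  assumes "open S" "x \<in> S" "\<And>y. y \<in> S \<Longrightarrow> f y = g y"
  shows "dir_deriv f x v = dir_deriv g x v"
proof -
  have "(f has_derivative f') (at x) \<longleftrightarrow> (g has_derivative f') (at x)" for f'
    using assms has_derivative_transform_within_open[of f f' x UNIV S g]
      has_derivative_transform_within_open[of g f' x UNIV S f] by auto
  then show ?thesis by (simp add: frechet_derivative_def)
qed

lemma differentiable_cong_open:
  assumes "open S" "x \<in> S" "\<And>y. y \<in> S \<Longrightarrow> f y = g y"
  shows "f differentiable (at x) \<longleftrightarrow> g differentiable (at x)"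
proof -
  have "(f has_derivative f') (at x) \<longleftrightarrow> (g has_derivative f') (at x)" for f'
    using assms has_derivative_transform_within_open[of f f' x UNIV S g]
      has_derivative_transform_within_open[of g f' x UNIV S f] by auto
  then show ?thesis by (simp add: differentiable_def)
qed

lemma dir_deriv_inner:
  assumes "f differentiable (at x)"
  shows "dir_deriv (\<lambda>y. f y \<bullet> b) x v = dir_deriv f x v \<bullet> b"
  by (rule dir_deriv_eqI) (rule has_derivative_inner_left[OF has_derivative_dir_deriv[OF assms]])

lemma smooth_on_differentiable: "smooth_on S f \<Longrightarrow> x \<in> S \<Longrightarrow> f differentiable (at x)"
  using C_on.simps(2)[of 0 S f] unfolding smooth_on_def by blast

lemma smooth_on_dir_deriv: "smooth_on S f \<Longrightarrow> smooth_on S (\<lambda>x. dir_deriv f x v)"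
  unfolding smooth_on_def using C_on.simps(2)[of _ S f] by blast

lemma C_on_cong_open:
  assumes "open S" "\<And>y. y \<in> S \<Longrightarrow> f y = g y"
  shows "C_on k S f \<longleftrightarrow> C_on k S g"
  using assms(2)
proof (induction k arbitrary: f g)
  case 0 then show ?case by (simp cong: continuous_on_cong)
next
  case (Suc k)
  have "C_on k S (\<lambda>x. dir_deriv f x v) \<longleftrightarrow> C_on k S (\<lambda>x. dir_deriv g x v)" for v
    by (rule Suc.IH) (rule dir_deriv_cong_open[OF assms(1) _ Suc.prems])
  then show ?case
    using differentiable_cong_open[OF assms(1) _ Suc.prems] by auto
qed

text \<open>The zero section of an induced chart is the slice \<open>y \<mapsto> (y, 0)\<close>; this transports smoothness of a vector
field on the tangent bundle to the base.\<close>

lemma C_on_linear_slice: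
  fixes f :: "'a::euclidean_space \<times> 'b::euclidean_space \<Rightarrow> 'c::real_normed_vector"
    and L :: "'c \<Rightarrow> 'd::real_normed_vector"
  assumes "open S" "bounded_linear L" "C_on k (S \<times> UNIV) f"
  shows "C_on k S (\<lambda>y. L (f (y, 0)))"
  using assms(3)
proof (induction k arbitrary: f)
  case 0
  have "continuous_on S (\<lambda>y. f (y, 0))"
    by (rule continuous_on_compose2[of "S \<times> UNIV" f])
       (use 0 in \<open>auto intro!: continuous_intros\<close>)
  then show ?case
    using bounded_linear.continuous_on[OF assms(2)] by simp
next
  case (Suc k)
  have der: "((\<lambda>y. L (f (y, 0))) has_derivative (\<lambda>v. L (dir_deriv f (y, 0) (v, 0)))) (at y)"
    if "y \<in> S" for y
  proof -
    have f: "(f has_derivative dir_deriv f (y, 0)) (at (y, 0))"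
      using Suc.prems that by (simp add: has_derivative_dir_deriv)
    have "((\<lambda>y. (y, 0::'b)) has_derivative (\<lambda>v. (v, 0))) (at y)"
      by (auto intro!: derivative_eq_intros)
    from has_derivative_compose[OF this f]
    show ?thesis by (rule bounded_linear.has_derivative[OF assms(2)])
  qed
  have "C_on k S (\<lambda>y. dir_deriv (\<lambda>y. L (f (y, 0))) y v)" for v
  proof -
    have "C_on k S (\<lambda>y. L (dir_deriv f (y, 0) (v, 0)))"
      using Suc.IH[of "\<lambda>z. dir_deriv f z (v, 0)"] Suc.prems by simp
    then show ?thesis
      by (subst C_on_cong_open[OF assms(1) dir_deriv_eqI[OF der]])
  qed
  then show ?case using der by (auto simp: differentiable_def)
qed

lemma smooth_on_add:
  fixes f g :: "'a::euclidean_space \<Rightarrow> 'b::real_normed_vector"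
  assumes "open S" "smooth_on S f" "smooth_on S g"
  shows "smooth_on S (\<lambda>x. f x + g x)"
proof -
  have "C_on k S (\<lambda>x. f x + g x)" if "smooth_on S f" "smooth_on S g" for k and f g :: "'a \<Rightarrow> 'b"
    using that
  proof (induction k arbitrary: f g)
    case 0
    then have "C_on 0 S f" "C_on 0 S g" unfolding smooth_on_def by blast+
    then show ?case by (simp add: continuous_on_add)
  next
    case (Suc k)
    have d: "f differentiable (at x)" "g differentiable (at x)" if "x \<in> S" for x
      using Suc.prems that by (auto intro: smooth_on_differentiable)
    have eq: "dir_deriv (\<lambda>x. f x + g x) x v = dir_deriv f x v + dir_deriv g x v" if "x \<in> S" for x v
      using d[OF that] by (intro dir_deriv_eqI has_derivative_add has_derivative_dir_deriv)
    have "C_on k S (\<lambda>x. dir_deriv (\<lambda>x. f x + g x) x v)" for v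
      using Suc.IH[OF smooth_on_dir_deriv[OF Suc.prems(1)] smooth_on_dir_deriv[OF Suc.prems(2)], of v v]
      by (subst C_on_cong_open[OF assms(1) eq])
    then show ?case using d by (auto intro: differentiable_add)
  qed
  then show ?thesis using assms(2,3) by (auto simp: smooth_on_def)
qed

lemma smooth_on_inner:
  fixes f :: "'a::euclidean_space \<Rightarrow> 'b::real_inner"
  assumes "open S" "smooth_on S f"
  shows "smooth_on S (\<lambda>y. f y \<bullet> b)"
proof -
  have "C_on k S (\<lambda>y. f y \<bullet> b)" if "smooth_on S f" for k and f :: "'a \<Rightarrow> 'b"
    using that
  proof (induction k arbitrary: f)
    case 0
    then have "C_on 0 S f" unfolding smooth_on_def by blast
    then show ?case by (simp add: continuous_on_inner)
  next
    case (Suc k)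
    have "C_on k S (\<lambda>y. dir_deriv (\<lambda>y. f y \<bullet> b) y v)" for v
      using Suc.IH[OF smooth_on_dir_deriv[OF Suc.prems, of v]]
      by (subst C_on_cong_open[OF assms(1) dir_deriv_inner[OF smooth_on_differentiable[OF Suc.prems]]])
    then show ?case
      using smooth_on_differentiable[OF Suc.prems] 
      by (auto intro: differentiable_inner)
  qed
  then show ?thesis using assms(2) by (auto simp: smooth_on_def)
qed

text \<open>By the mean value theorem in the direction \<open>X\<close>, the second difference of \<open>f\<close> is \<open>h\<close> times an increment
of the partial derivative in the direction \<open>X\<close>, which is known to first order. The second difference is
symmetric in \<open>X\<close> and \<open>Y\<close>, hence so is the limit: this is how mixed partial derivatives are shown to
commute.\<close>

lemma second_difference_quotient_tendsto:
  fixes f :: "'a::euclidean_space \<Rightarrow> real"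
  assumes U: "open U" "p \<in> U" and f: "\<And>y. y \<in> U \<Longrightarrow> f differentiable (at y)"
    and L: "((\<lambda>y. dir_deriv f y X) has_derivative L) (at p)"
  shows "((\<lambda>h. (f (p + h *\<^sub>R X + h *\<^sub>R Y) - f (p + h *\<^sub>R X) - f (p + h *\<^sub>R Y) + f p) / h\<^sup>2)
    \<longlongrightarrow> L Y) (at_right 0)"
proof -
  interpret L: bounded_linear L using L by (rule has_derivative_bounded_linear)
  define N where "N = 2 * norm X + norm Y + 1"
  have N: "N > 0" by (simp add: N_def add_nonneg_pos)
  show ?thesis
  proof (rule tendstoI)
    fix e :: real assume e: "e > 0"
    (* The error is at most \<open>e'\<close> times \<open>2 * norm X + norm Y\<close>, and \<open>N\<close> exceeds the latter to be positive. *)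
    define e' where "e' = e / (2 * N)"
    have e': "e' > 0" using e N by (simp add: e'_def)
    obtain d1 where d1: "d1 > 0" and ball: "ball p d1 \<subseteq> U"
      using U openE by blast
    obtain d2 where d2: "d2 > 0" and
      est: "\<And>z. norm (z - p) < d2 \<Longrightarrow> norm (dir_deriv f z X - dir_deriv f p X - L (z - p)) \<le> e' * norm (z - p)"
      using L e' unfolding has_derivative_at_alt by meson
    define d where "d = min d1 d2 / N"
    have d: "d > 0" using d1 d2 N by (simp add: d_def)
    have "dist ((f (p + h *\<^sub>R X + h *\<^sub>R Y) - f (p + h *\<^sub>R X) - f (p + h *\<^sub>R Y) + f p) / h\<^sup>2) (L Y) < e"
      if h: "0 < h" "h < d" for h
    proof -
      have hN: "h * N < d1" "h * N < d2"
        using h N by (auto simp: d_def field_simps)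
      have small: "norm (t *\<^sub>R X + s *\<^sub>R Y) \<le> h * (norm X + norm Y)"
        if "0 \<le> t" "t \<le> h" "0 \<le> s" "s \<le> h" for t s
      proof -
        have "norm (t *\<^sub>R X + s *\<^sub>R Y) \<le> t * norm X + s * norm Y"
          using norm_triangle_ineq[of "t *\<^sub>R X" "s *\<^sub>R Y"] that by simp
        also have "\<dots> \<le> h * norm X + h * norm Y"
          using that by (intro add_mono mult_right_mono) auto
        finally show ?thesis by (simp add: distrib_left)
      qed
      have "norm X + norm Y \<le> N" by (simp add: N_def)
      then have "h * (norm X + norm Y) \<le> h * N"
        using h by (intro mult_left_mono) auto
      then have lt: "norm (t *\<^sub>R X + s *\<^sub>R Y) < d1" "norm (t *\<^sub>R X + s *\<^sub>R Y) < d2"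
        if "0 \<le> t" "t \<le> h" "0 \<le> s" "s \<le> h" for t s
        using small[OF that] hN by auto
      have inU: "p + t *\<^sub>R X + s *\<^sub>R Y \<in> U" if "0 \<le> t" "t \<le> h" "0 \<le> s" "s \<le> h" for t s
        proof -
        have "dist p (p + t *\<^sub>R X + s *\<^sub>R Y) = norm (t *\<^sub>R X + s *\<^sub>R Y)"
          by (simp add: dist_norm add.assoc flip: norm_minus_cancel[of "t *\<^sub>R X + s *\<^sub>R Y"])
        then show ?thesis using lt(1)[OF that] ball by (metis mem_ball subsetD)
      qed
      define \<phi> where "\<phi> t = f (p + t *\<^sub>R X + h *\<^sub>R Y) - f (p + t *\<^sub>R X)" for t
      have D: "((\<lambda>t. f (p + t *\<^sub>R X + s *\<^sub>R Y)) has_real_derivative dir_deriv f (p + t *\<^sub>R X + s *\<^sub>R Y) X) (at t)"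
        if "0 \<le> t" "t \<le> h" "0 \<le> s" "s \<le> h" for t s
      proof -
        have a: "((\<lambda>t. p + t *\<^sub>R X + s *\<^sub>R Y) has_derivative (\<lambda>v. v *\<^sub>R X)) (at t)"
          by (auto intro!: derivative_eq_intros)
        have b: "(f has_derivative dir_deriv f (p + t *\<^sub>R X + s *\<^sub>R Y)) (at (p + t *\<^sub>R X + s *\<^sub>R Y))"
          by (rule has_derivative_dir_deriv[OF f[OF inU[OF that]]])
        interpret b: bounded_linear "dir_deriv f (p + t *\<^sub>R X + s *\<^sub>R Y)"
          using b by (rule has_derivative_bounded_linear)
        have "(\<lambda>v. dir_deriv f (p + t *\<^sub>R X + s *\<^sub>R Y) (v *\<^sub>R X)) =
            (*) (dir_deriv f (p + t *\<^sub>R X + s *\<^sub>R Y) X)"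
          by (rule ext) (simp add: b.scaleR)
        then show ?thesis
          using has_derivative_compose[OF a b] by (simp add: has_field_derivative_def)
      qed
      have "\<exists>\<theta>. 0 < \<theta> \<and> \<theta> < h \<and> \<phi> h - \<phi> 0 = (h - 0) *
          (dir_deriv f (p + \<theta> *\<^sub>R X + h *\<^sub>R Y) X - dir_deriv f (p + \<theta> *\<^sub>R X) X)"
      proof (rule MVT2)
        show "0 < h" by fact
        fix t assume "0 \<le> t" "t \<le> h"
        then show "DERIV \<phi> t :> dir_deriv f (p + t *\<^sub>R X + h *\<^sub>R Y) X - dir_deriv f (p + t *\<^sub>R X) X"
          unfolding \<phi>_def using D[of t h] D[of t 0] h by (auto intro!: DERIV_diff)
      qed
      then obtain \<theta> where \<theta>: "0 < \<theta>" "\<theta> < h" and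
        mv: "\<phi> h - \<phi> 0 = h * (dir_deriv f (p + \<theta> *\<^sub>R X + h *\<^sub>R Y) X - dir_deriv f (p + \<theta> *\<^sub>R X) X)"
        by auto
      let ?A = "dir_deriv f (p + \<theta> *\<^sub>R X + h *\<^sub>R Y) X - dir_deriv f p X - L (\<theta> *\<^sub>R X + h *\<^sub>R Y)"
      let ?B = "dir_deriv f (p + \<theta> *\<^sub>R X) X - dir_deriv f p X - L (\<theta> *\<^sub>R X)"
      have A: "\<bar>?A\<bar> \<le> e' * (h * (norm X + norm Y))"
      proof -
        have "\<bar>?A\<bar> \<le> e' * norm (\<theta> *\<^sub>R X + h *\<^sub>R Y)"
          using est[of "p + \<theta> *\<^sub>R X + h *\<^sub>R Y"] lt(2)[of \<theta> h] \<theta> h by (simp add: add.assoc)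
        also have "\<dots> \<le> e' * (h * (norm X + norm Y))"
          using small[of \<theta> h] \<theta> h e' by (intro mult_left_mono) auto
        finally show ?thesis .
      qed
      have B: "\<bar>?B\<bar> \<le> e' * (h * norm X)"
      proof -
        have "\<bar>?B\<bar> \<le> e' * norm (\<theta> *\<^sub>R X)"
          using est[of "p + \<theta> *\<^sub>R X"] lt(2)[of \<theta> 0] \<theta> h by simp
        also have "\<dots> \<le> e' * (h * norm X)"
          using \<theta> e' by (intro mult_left_mono) (auto intro: mult_right_mono)
        finally show ?thesis .
      qed
      have eq: "(f (p + h *\<^sub>R X + h *\<^sub>R Y) - f (p + h *\<^sub>R X) - f (p + h *\<^sub>R Y) + f p) / h\<^sup>2 - L Y
        = (?A - ?B) / h"
      proof -
        have "f (p + h *\<^sub>R X + h *\<^sub>R Y) - f (p + h *\<^sub>R X) - f (p + h *\<^sub>R Y) + f p = \<phi> h - \<phi> 0"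
          by (simp add: \<phi>_def)
        also have "\<dots> = h * (?A - ?B + h * L Y)"
          unfolding mv by (simp add: L.add L.scaleR)
        finally have "f (p + h *\<^sub>R X + h *\<^sub>R Y) - f (p + h *\<^sub>R X) - f (p + h *\<^sub>R Y) + f p = h * (?A - ?B + h * L Y)" .
        moreover have "h * (K + h * l) / h\<^sup>2 - l = K / h" for K l
          using h by (simp add: field_simps power2_eq_square)
        ultimately show ?thesis by (simp only:)
      qed
      have "\<bar>?A - ?B\<bar> \<le> e' * h * (2 * norm X + norm Y)"
        using A B by (simp add: algebra_simps)
      also have "\<dots> \<le> e' * h * N"
        using e' h by (intro mult_left_mono) (auto simp: N_def)
      finally have "\<bar>(?A - ?B) / h\<bar> \<le> e' * N"
        using h by (simp add: field_simps)
      also have "\<dots> < e" using e N by (simp add: e'_def)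
      finally show ?thesis unfolding dist_real_def eq .
    qed
    then show "\<forall>\<^sub>F h in at_right 0. dist ((f (p + h *\<^sub>R X + h *\<^sub>R Y) - f (p + h *\<^sub>R X) - f (p + h *\<^sub>R Y) + f p) / h\<^sup>2) (L Y) < e"
      using d unfolding eventually_at_right_field by blast
  qed
qed

lemma dir_deriv_commute_real:
  fixes f :: "'a::euclidean_space \<Rightarrow> real"
  assumes U: "open U" "p \<in> U" and f: "smooth_on U f"
  shows "dir_deriv (\<lambda>y. dir_deriv f y X) p Y = dir_deriv (\<lambda>y. dir_deriv f y Y) p X"
proof -
  let ?q = "\<lambda>X Y h. (f (p + h *\<^sub>R X + h *\<^sub>R Y) - f (p + h *\<^sub>R X) - f (p + h *\<^sub>R Y) + f p) / h\<^sup>2"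
  have lim: "(?q X Y \<longlongrightarrow> dir_deriv (\<lambda>y. dir_deriv f y X) p Y) (at_right 0)" for X Y
    using U f by (intro second_difference_quotient_tendsto[OF U])
      (auto intro: smooth_on_differentiable smooth_on_dir_deriv has_derivative_dir_deriv)
  have "?q Y X = ?q X Y" by (rule ext) (simp add: ac_simps)
  with lim[of Y X] have "(?q X Y \<longlongrightarrow> dir_deriv (\<lambda>y. dir_deriv f y Y) p X) (at_right 0)"
    by simp
  with lim[of X Y] show ?thesis
    by (rule tendsto_unique[OF trivial_limit_at_right_real])
qed

text \<open>Clairaut's theorem.\<close>

lemma dir_deriv_commute:
  fixes f :: "'a::euclidean_space \<Rightarrow> 'b::euclidean_space"
  assumes U: "open U" "p \<in> U" and f: "smooth_on U f"
  shows "dir_deriv (\<lambda>y. dir_deriv f y X) p Y = dir_deriv (\<lambda>y. dir_deriv f y Y) p X"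
proof (rule euclidean_eqI)
  fix b :: 'b assume "b \<in> Basis"
  have eq: "dir_deriv (\<lambda>y. dir_deriv f y X) p Y \<bullet> b = dir_deriv (\<lambda>y. dir_deriv (\<lambda>y. f y \<bullet> b) y X) p Y" for X Y
  proof -
    have "dir_deriv (\<lambda>y. dir_deriv f y X) p Y \<bullet> b = dir_deriv (\<lambda>y. dir_deriv f y X \<bullet> b) p Y"
      by (rule dir_deriv_inner[symmetric])
        (rule smooth_on_differentiable[OF smooth_on_dir_deriv[OF f] U(2)])
    also have "\<dots> = dir_deriv (\<lambda>y. dir_deriv (\<lambda>y. f y \<bullet> b) y X) p Y"
      by (rule dir_deriv_cong_open[OF U]) (simp add: dir_deriv_inner smooth_on_differentiable[OF f])
    finally show ?thesis .
  qed
  show "dir_deriv (\<lambda>y. dir_deriv f y X) p Y \<bullet> b = dir_deriv (\<lambda>y. dir_deriv f y Y) p X \<bullet> b"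
    unfolding eq by (rule dir_deriv_commute_real[OF U smooth_on_inner[OF U(1) f]])
qed

text \<open>The tangent map of \<open>f\<close>, in coordinates; applied to a change of charts it is the change of the induced
charts of the tangent bundle. Its derivative contains the second derivative of \<open>f\<close>, the term that the
transformation law of the Christoffel symbols compensates.\<close>

lemma has_derivative_tangent_map:
  fixes f :: "'a::euclidean_space \<Rightarrow> 'b::euclidean_space"
  assumes S: "open S" "y \<in> S" and f: "smooth_on S f"
  shows "((\<lambda>(y, w). (f y, dir_deriv f y w)) has_derivative
    (\<lambda>(X, W). (dir_deriv f y X, dir_deriv (\<lambda>y. dir_deriv f y w) y X + dir_deriv f y W))) (at (y, w))"
proof -
  have lin: "linear (dir_deriv f z)" if "z \<in> S" for z
    by (rule linear_frechet_derivative[OF smooth_on_differentiable[OF f that]])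
  have expand: "dir_deriv f z w = (\<Sum>b\<in>Basis. (w \<bullet> b) *\<^sub>R dir_deriv f z b)" if "z \<in> S" for z w
  proof -
    have "dir_deriv f z w = dir_deriv f z (\<Sum>b\<in>Basis. (w \<bullet> b) *\<^sub>R b)" by (simp add: euclidean_representation)
    then show ?thesis by (simp add: linear_sum[OF lin[OF that]] linear_scale[OF lin[OF that]])
  qed
  have D2: "((\<lambda>z. dir_deriv f z b) has_derivative dir_deriv (\<lambda>z. dir_deriv f z b) y) (at y)" for b
    by (rule has_derivative_dir_deriv[OF smooth_on_differentiable[OF smooth_on_dir_deriv[OF f] S(2)]])
  have expand2: "dir_deriv (\<lambda>z. dir_deriv f z w) y X = (\<Sum>b\<in>Basis. (w \<bullet> b) *\<^sub>R dir_deriv (\<lambda>z. dir_deriv f z b) y X)" for X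
  proof -
    have "dir_deriv (\<lambda>z. dir_deriv f z w) y X = dir_deriv (\<lambda>z. \<Sum>b\<in>Basis. (w \<bullet> b) *\<^sub>R dir_deriv f z b) y X"
      by (rule dir_deriv_cong_open[OF S]) (rule expand)
    also have "\<dots> = (\<Sum>b\<in>Basis. (w \<bullet> b) *\<^sub>R dir_deriv (\<lambda>z. dir_deriv f z b) y X)"
      by (rule dir_deriv_eqI) (intro has_derivative_sum has_derivative_scaleR_right D2)
    finally show ?thesis .
  qed
  have fst': "(fst has_derivative fst) (at (y, w))" and snd': "(snd has_derivative snd) (at (y, w))"
    by (auto intro!: has_derivative_fst has_derivative_snd)
  have D2': "((\<lambda>p. dir_deriv f (fst p) b) has_derivative
      (\<lambda>v. dir_deriv (\<lambda>z. dir_deriv f z b) y (fst v))) (at (y, w))" for b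
    by (rule has_derivative_compose[OF fst']) (simp add: D2)
  have D1: "((\<lambda>p. f (fst p)) has_derivative (\<lambda>v. dir_deriv f y (fst v))) (at (y, w))"
    by (rule has_derivative_compose[OF fst'])
      (simp add: has_derivative_dir_deriv[OF smooth_on_differentiable[OF f S(2)]])
  have "((\<lambda>p. (f (fst p), \<Sum>b\<in>Basis. (snd p \<bullet> b) *\<^sub>R dir_deriv f (fst p) b)) has_derivative
      (\<lambda>v. (dir_deriv f y (fst v), \<Sum>b\<in>Basis. (snd (y, w) \<bullet> b) *\<^sub>R dir_deriv (\<lambda>z. dir_deriv f z b) y (fst v)
        + (snd v \<bullet> b) *\<^sub>R dir_deriv f (fst (y, w)) b))) (at (y, w))"
    by (intro has_derivative_Pair has_derivative_sum has_derivative_scaleR D1 D2' has_derivative_inner_left snd')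
  moreover have "(\<lambda>v. (dir_deriv f y (fst v), \<Sum>b\<in>Basis. (snd (y, w) \<bullet> b) *\<^sub>R dir_deriv (\<lambda>z. dir_deriv f z b) y (fst v)
        + (snd v \<bullet> b) *\<^sub>R dir_deriv f (fst (y, w)) b)) =
      (\<lambda>(X, W). (dir_deriv f y X, dir_deriv (\<lambda>y. dir_deriv f y w) y X + dir_deriv f y W))"
    by (auto simp: fun_eq_iff sum.distrib expand2 expand[OF S(2), symmetric])
  ultimately have D: "((\<lambda>p. (f (fst p), \<Sum>b\<in>Basis. (snd p \<bullet> b) *\<^sub>R dir_deriv f (fst p) b)) has_derivative
      (\<lambda>(X, W). (dir_deriv f y X, dir_deriv (\<lambda>y. dir_deriv f y w) y X + dir_deriv f y W))) (at (y, w))"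
    by (simp only:)
  have "open (S \<times> (UNIV :: 'a set))" using S by (simp add: open_Times)
  then show ?thesis
    by (rule has_derivative_transform_within_open[OF D, where s = "S \<times> UNIV"])
      (use S in \<open>auto simp flip: expand\<close>)
qed

lemma has_derivative_zero_slice:
  fixes F :: "'a::euclidean_space \<times> 'b::euclidean_space \<Rightarrow> 'c::real_normed_vector"
  assumes "F differentiable (at (y, 0))"
  shows "((\<lambda>y. F (y, 0)) has_derivative (\<lambda>T. dir_deriv F (y, 0) (T, 0))) (at y)"
proof -
  have "((\<lambda>y. (y, 0::'b)) has_derivative (\<lambda>v. (v, 0))) (at y)"
    by (auto intro!: derivative_eq_intros)
  from has_derivative_compose[OF this has_derivative_dir_deriv[OF assms]] show ?thesis .
qed

lemmas dir_deriv_zero_slice = dir_deriv_eqI[OF has_derivative_zero_slice]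

lemma has_real_derivative_fibre_line:
  fixes F :: "'a::euclidean_space \<times> 'b::euclidean_space \<Rightarrow> real"
  assumes "F differentiable (at (y, r *\<^sub>R W))"
  shows "((\<lambda>r. F (y, r *\<^sub>R W)) has_real_derivative dir_deriv F (y, r *\<^sub>R W) (0, W)) (at r)"
proof -
  have F: "(F has_derivative dir_deriv F (y, r *\<^sub>R W)) (at (y, r *\<^sub>R W))"
    by (rule has_derivative_dir_deriv[OF assms])
  interpret bounded_linear "dir_deriv F (y, r *\<^sub>R W)"
    using F by (rule has_derivative_bounded_linear)
  have "((\<lambda>r. (y, r *\<^sub>R W)) has_derivative (\<lambda>v. (0, v *\<^sub>R W))) (at r)"
    by (auto intro!: derivative_eq_intros)
  from has_derivative_compose[OF this F]
  have "((\<lambda>r. F (y, r *\<^sub>R W)) has_derivative (\<lambda>v. dir_deriv F (y, r *\<^sub>R W) (0, v *\<^sub>R W))) (at r)" .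
  moreover have "(\<lambda>v. dir_deriv F (y, r *\<^sub>R W) (0, v *\<^sub>R W)) = (*) (dir_deriv F (y, r *\<^sub>R W) (0, W))"
  proof
    fix v show "dir_deriv F (y, r *\<^sub>R W) (0, v *\<^sub>R W) = dir_deriv F (y, r *\<^sub>R W) (0, W) * v"
      using scaleR[of v "(0, W)"] by simp
  qed
  ultimately show ?thesis by (simp add: has_field_derivative_def)
qed

section \<open>Functions of one real variable\<close>

lemma smooth_on_has_deriv:
  fixes f :: "real \<Rightarrow> real"
  assumes "smooth_on UNIV f"
  shows "(f has_real_derivative deriv f t) (at t)"
    and "(deriv f has_real_derivative deriv (deriv f) t) (at t)"
proof -
  have d: "(f has_real_derivative deriv f t) (at t)" if "f differentiable (at t)" for f :: "real \<Rightarrow> real" and t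
    using that by (simp add: DERIV_deriv_iff_real_differentiable)
  show 1: "(f has_real_derivative deriv f t) (at t)" for t
    by (rule d) (simp add: smooth_on_differentiable[OF assms])
  have "dir_deriv f t 1 = deriv f t" for t
    using dir_deriv_eqI[OF 1[of t, unfolded has_field_derivative_def], of 1] by simp
  moreover have "(\<lambda>t. dir_deriv f t 1) differentiable (at t)"
    by (rule smooth_on_differentiable[OF smooth_on_dir_deriv[OF assms]]) simp
  ultimately show "(deriv f has_real_derivative deriv (deriv f) t) (at t)"
    by (intro d) simp
qed

lemma half_line_deriv_eq:
  assumes "smooth_on UNIV F" "\<And>t. t \<ge> 0 \<Longrightarrow> f t = F t"
  shows "half_line_deriv f 0 = deriv F 0"
proof (rule vector_derivative_within)
  show "at (0::real) within {0..} \<noteq> bot"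
    by (simp add: at_within_Ici_at_right trivial_limit_at_right_real)
  have "(F has_vector_derivative deriv F 0) (at 0 within {0..})"
    using smooth_on_has_deriv(1)[OF assms(1), of 0]
    by (simp add: has_real_derivative_iff_has_vector_derivative has_vector_derivative_at_within)
  then show "(f has_vector_derivative deriv F 0) (at 0 within {0..})"
    by (rule has_vector_derivative_transform[rotated 2]) (simp_all add: assms(2))
qed

text \<open>The coefficients of a natural metric depend on the squared length of the fibre variable and are hence
stationary along fibre lines through the zero section.\<close>

lemma has_derivative_even_coefficient:
  fixes \<psi> P :: "real \<Rightarrow> real"
  assumes "smooth_on UNIV \<psi>" and P: "(P has_real_derivative P') (at 0)"
  shows "((\<lambda>r. \<psi> (r\<^sup>2 * \<tau>) * P r) has_real_derivative \<psi> 0 * P') (at 0)"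
proof -
  have "((\<lambda>r. \<psi> (r\<^sup>2 * \<tau>)) has_real_derivative deriv \<psi> (0\<^sup>2 * \<tau>) * (2 * 0 * \<tau>)) (at 0)"
    by (rule DERIV_chain2[OF smooth_on_has_deriv(1)[OF assms(1)]])
      (auto intro!: derivative_eq_intros)
  from DERIV_mult[OF this P] show ?thesis by (simp add: mult.commute[of P'])
qed

text \<open>The coefficient \<open>G((Y,0),(Z,0))\<close> of a natural metric, restricted to the fibre line \<open>r \<mapsto> r W\<close>, has this
shape, with \<open>\<tau> = g(W, W)\<close>. As the arguments \<open>r\<^sup>2 \<tau>\<close> have vanishing derivative at 0, only the terms of degree 0 and 2 in \<open>r\<close>
contribute to the second derivative, and of the term of degree 0 only the first derivative of its coefficient.\<close>

lemma second_derivative_even_expansion: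
  fixes a b c p q s :: "real \<Rightarrow> real"
  assumes smooth: "\<And>f. f \<in> {a, b, c, p, q, s} \<Longrightarrow> smooth_on UNIV f"
    and f: "\<And>r. f r = k * a (r\<^sup>2 * \<tau>) + l * r * b (r\<^sup>2 * \<tau>) + n * r\<^sup>2 * c (r\<^sup>2 * \<tau>)
      + m * r\<^sup>2 * p (r\<^sup>2 * \<tau>) + d * r ^ 3 * q (r\<^sup>2 * \<tau>) + e * r ^ 4 * s (r\<^sup>2 * \<tau>)"
    and f': "\<And>r. (f has_real_derivative f' r) (at r)" and f'': "(f' has_real_derivative f'') (at 0)"
  shows "f'' = 2 * \<tau> * k * deriv a 0 + 2 * n * c 0 + 2 * m * p 0"
proof -
  have D: "((\<lambda>r. \<psi> (r\<^sup>2 * \<tau>)) has_real_derivative deriv \<psi> (r\<^sup>2 * \<tau>) * (2 * r * \<tau>)) (at r)"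
    if "\<psi> \<in> {a, b, c, p, q, s}" for \<psi> r
    by (rule DERIV_chain2[OF smooth_on_has_deriv(1)[OF smooth[OF that]]])
      (auto intro!: derivative_eq_intros)
  have D2: "((\<lambda>r. deriv \<psi> (r\<^sup>2 * \<tau>)) has_real_derivative deriv (deriv \<psi>) (r\<^sup>2 * \<tau>) * (2 * r * \<tau>)) (at r)"
    if "\<psi> \<in> {a, b, c, p, q, s}" for \<psi> r
    by (rule DERIV_chain2[OF smooth_on_has_deriv(2)[OF smooth[OF that]]])
      (auto intro!: derivative_eq_intros)
  note Ds = D[of a] D[of b] D[of c] D[of p] D[of q] D[of s]
  note D2s = D2[of a] D2[of b] D2[of c] D2[of p] D2[of q] D2[of s]
  let ?g = "\<lambda>r. k * (deriv a (r\<^sup>2 * \<tau>) * (2 * r * \<tau>)) + (l * b (r\<^sup>2 * \<tau>) + l * r * (deriv b (r\<^sup>2 * \<tau>) * (2 * r * \<tau>)))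
    + (n * (2 * r) * c (r\<^sup>2 * \<tau>) + n * r\<^sup>2 * (deriv c (r\<^sup>2 * \<tau>) * (2 * r * \<tau>)))
    + (m * (2 * r) * p (r\<^sup>2 * \<tau>) + m * r\<^sup>2 * (deriv p (r\<^sup>2 * \<tau>) * (2 * r * \<tau>)))
    + (d * (3 * r\<^sup>2) * q (r\<^sup>2 * \<tau>) + d * r ^ 3 * (deriv q (r\<^sup>2 * \<tau>) * (2 * r * \<tau>)))
    + (e * (4 * r ^ 3) * s (r\<^sup>2 * \<tau>) + e * r ^ 4 * (deriv s (r\<^sup>2 * \<tau>) * (2 * r * \<tau>)))"
  have "(f has_real_derivative ?g r) (at r)" for r
    unfolding f[abs_def]
    by (rule derivative_eq_intros Ds refl | simp)+
  then have "f' = ?g" using f' DERIV_unique by blast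
  moreover have "(?g has_real_derivative 2 * \<tau> * k * deriv a 0 + 2 * n * c 0 + 2 * m * p 0) (at 0)"
    by (rule derivative_eq_intros Ds D2s refl | simp)+
  ultimately show ?thesis using f'' DERIV_unique by blast
qed

section \<open>The Levi-Civita connection of a metric in coordinates\<close>

lemma bilinear_real_expand:
  fixes H :: "'a::euclidean_space \<Rightarrow> 'a \<Rightarrow> real"
  assumes "bilinear H"
  shows "H X Z = (\<Sum>b\<in>Basis. \<Sum>c\<in>Basis. (X \<bullet> b) * (Z \<bullet> c) * H b c)"
proof -
  have l: "linear (\<lambda>X. H X Z)" for Z using assms by (auto simp: bilinear_def)
  have r: "linear (H X)" for X using assms by (auto simp: bilinear_def)
  have "H X Z = H (\<Sum>b\<in>Basis. (X \<bullet> b) *\<^sub>R b) Z" by (simp add: euclidean_representation)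
  also have "\<dots> = (\<Sum>b\<in>Basis. (X \<bullet> b) * H b Z)"
    by (simp add: linear_sum[OF l] linear_scale[OF l])
  also have "\<dots> = (\<Sum>b\<in>Basis. (X \<bullet> b) * H b (\<Sum>c\<in>Basis. (Z \<bullet> c) *\<^sub>R c))"
    by (simp add: euclidean_representation)
  also have "\<dots> = (\<Sum>b\<in>Basis. \<Sum>c\<in>Basis. (X \<bullet> b) * (Z \<bullet> c) * H b c)"
    by (simp add: linear_sum[OF r] linear_scale[OF r] sum_distrib_left mult.assoc)
  finally show ?thesis .
qed

text \<open>The coordinate expression of a pseudo-Riemannian metric on an open set of the model space.\<close>

locale local_metric =
  fixes U :: "'e::euclidean_space set" and h :: "'e \<Rightarrow> 'e \<Rightarrow> 'e \<Rightarrow> real"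
  assumes open_U: "open U"
    and bilin: "y \<in> U \<Longrightarrow> bilinear (h y)"
    and sym: "y \<in> U \<Longrightarrow> h y X Y = h y Y X"
    and nondegenerate: "y \<in> U \<Longrightarrow> (\<And>Z. h y X Z = 0) \<Longrightarrow> X = 0"
    and smooth: "smooth_on U (\<lambda>y. h y X Y)"
begin

abbreviation Dh :: "'e \<Rightarrow> 'e \<Rightarrow> 'e \<Rightarrow> 'e \<Rightarrow> real" where
  "Dh y V X Y \<equiv> dir_deriv (\<lambda>z. h z X Y) y V"

abbreviation D2h :: "'e \<Rightarrow> 'e \<Rightarrow> 'e \<Rightarrow> 'e \<Rightarrow> 'e \<Rightarrow> real" where
  "D2h y V W X Y \<equiv> dir_deriv (\<lambda>z. Dh z W X Y) y V"

lemma h_linear: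
  assumes "y \<in> U"
  shows "h y (X + X') Y = h y X Y + h y X' Y" "h y X (Y + Y') = h y X Y + h y X Y'"
    "h y (a *\<^sub>R X) Y = a * h y X Y" "h y X (a *\<^sub>R Y) = a * h y X Y"
    "h y (- X) Y = - h y X Y" "h y X (- Y) = - h y X Y"
    "h y (X - X') Y = h y X Y - h y X' Y" "h y X (Y - Y') = h y X Y - h y X Y'"
    "h y 0 Y = 0" "h y X 0 = 0"
  using bilinear_ladd[OF bilin[OF assms]] bilinear_radd[OF bilin[OF assms]]
    bilinear_lmul[OF bilin[OF assms]] bilinear_rmul[OF bilin[OF assms]]
    bilinear_lneg[OF bilin[OF assms]] bilinear_rneg[OF bilin[OF assms]]
    bilinear_lsub[OF bilin[OF assms]] bilinear_rsub[OF bilin[OF assms]]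
    bilinear_lzero[OF bilin[OF assms]] bilinear_rzero[OF bilin[OF assms]]
  by simp_all

lemma h_eqI: "y \<in> U \<Longrightarrow> (\<And>Z. h y X Z = h y X' Z) \<Longrightarrow> X = X'"
  using nondegenerate[of y "X - X'"] by (simp add: h_linear)

lemma metric_differentiable: "y \<in> U \<Longrightarrow> (\<lambda>z. h z X Y) differentiable (at y)"
  by (rule smooth_on_differentiable[OF smooth])

lemma Dh_differentiable: "y \<in> U \<Longrightarrow> (\<lambda>z. Dh z V X Y) differentiable (at y)"
  by (rule smooth_on_differentiable[OF smooth_on_dir_deriv[OF smooth]])

lemma Dh_linear: "y \<in> U \<Longrightarrow> linear (\<lambda>V. Dh y V X Y)"
  by (rule linear_frechet_derivative[OF metric_differentiable])

lemma Dh_expand: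
  assumes "y \<in> U"
  shows "Dh y V X Z = (\<Sum>b\<in>Basis. \<Sum>c\<in>Basis. (X \<bullet> b) * (Z \<bullet> c) * Dh y V b c)"
proof -
  have "Dh y V X Z = dir_deriv (\<lambda>z. \<Sum>b\<in>Basis. \<Sum>c\<in>Basis. (X \<bullet> b) * (Z \<bullet> c) * h z b c) y V"
    by (rule dir_deriv_cong_open[OF open_U assms]) (rule bilinear_real_expand[OF bilin])
  also have "\<dots> = (\<Sum>b\<in>Basis. \<Sum>c\<in>Basis. (X \<bullet> b) * (Z \<bullet> c) * Dh y V b c)"
    by (rule dir_deriv_eqI)
      (intro has_derivative_sum has_derivative_mult_right
        has_derivative_dir_deriv metric_differentiable assms)
  finally show ?thesis .
qed

lemma Dh_bilinear: 
  assumes "y \<in> U" shows "bilinear (Dh y V)"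
proof -
  have "bilinear (\<lambda>X Z. \<Sum>b\<in>Basis. \<Sum>c\<in>Basis. (X \<bullet> b) * (Z \<bullet> c) * Dh y V b c)"
    by (auto simp: bilinear_def inner_left_distrib sum.distrib sum_distrib_left algebra_simps intro!: linearI)
  moreover have "Dh y V = (\<lambda>X Z. \<Sum>b\<in>Basis. \<Sum>c\<in>Basis. (X \<bullet> b) * (Z \<bullet> c) * Dh y V b c)"
    by (intro ext) (rule Dh_expand[OF assms])
  ultimately show ?thesis by (simp only:)
qed

lemma Dh_sym: "y \<in> U \<Longrightarrow> Dh y V X Y = Dh y V Y X"
  by (rule dir_deriv_cong_open[OF open_U]) (auto intro: sym)

lemma D2h_commute: "y \<in> U \<Longrightarrow> D2h y V W X Y = D2h y W V X Y"
  by (rule dir_deriv_commute_real[OF open_U _ smooth])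

text \<open>The product rule for a metric evaluated along a map on two vector fields. The general base point map
covers both vector fields on the domain itself and the comparison of two charts.\<close>

lemma has_derivative_metric:
  fixes P :: "'f::real_normed_vector \<Rightarrow> 'e"
  assumes x: "P x \<in> U" and P: "(P has_derivative P') (at x)"
    and W: "(W has_derivative W') (at x)" and V: "(V has_derivative V') (at x)"
  shows "((\<lambda>z. h (P z) (W z) (V z)) has_derivative
    (\<lambda>v. Dh (P x) (P' v) (W x) (V x) + h (P x) (W' v) (V x) + h (P x) (W x) (V' v))) (at x)"
proof -
  let ?S = "\<lambda>z. \<Sum>b\<in>Basis. \<Sum>c\<in>Basis. (W z \<bullet> b) * (V z \<bullet> c) * h (P z) b c"
  have "isCont P x"
    using P by (rule has_derivative_continuous)
  then have ev: "\<forall>\<^sub>F z in at x. P z \<in> U"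
    using open_U x by (auto simp: isCont_def dest: topological_tendstoD)
  have S: "(?S has_derivative (\<lambda>v. \<Sum>b\<in>Basis. \<Sum>c\<in>Basis.
      (W x \<bullet> b) * (V x \<bullet> c) * Dh (P x) (P' v) b c
      + ((W x \<bullet> b) * (V' v \<bullet> c) + (W' v \<bullet> b) * (V x \<bullet> c)) * h (P x) b c)) (at x)"
    by (intro has_derivative_sum has_derivative_mult has_derivative_inner_left W V
        has_derivative_compose[OF P] has_derivative_dir_deriv metric_differentiable x)
  have eq: "h (P z) (W z) (V z) = ?S z" if "P z \<in> U" for z
    by (rule bilinear_real_expand[OF bilin[OF that]])
  have "((\<lambda>z. h (P z) (W z) (V z)) has_derivative (\<lambda>v. \<Sum>b\<in>Basis. \<Sum>c\<in>Basis.
      (W x \<bullet> b) * (V x \<bullet> c) * Dh (P x) (P' v) b c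
      + ((W x \<bullet> b) * (V' v \<bullet> c) + (W' v \<bullet> b) * (V x \<bullet> c)) * h (P x) b c)) (at x)"
    by (rule has_derivative_transform_eventually[OF S])
      (use ev eq x in \<open>auto elim: eventually_mono\<close>)
  moreover have "(\<Sum>b\<in>Basis. \<Sum>c\<in>Basis.
      (W x \<bullet> b) * (V x \<bullet> c) * Dh (P x) (P' v) b c
      + ((W x \<bullet> b) * (V' v \<bullet> c) + (W' v \<bullet> b) * (V x \<bullet> c)) * h (P x) b c)
    = Dh (P x) (P' v) (W x) (V x) + h (P x) (W' v) (V x) + h (P x) (W x) (V' v)" for v
    unfolding Dh_expand[OF x, where X = "W x" and Z = "V x"]
      bilinear_real_expand[OF bilin[OF x], of "W x" "V' v"]
      bilinear_real_expand[OF bilin[OF x], of "W' v" "V x"]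
    by (simp add: sum.distrib[symmetric] algebra_simps)
  ultimately show ?thesis by simp
qed

lemma dir_deriv_metric:
  assumes "y \<in> U" "W differentiable (at y)" "V differentiable (at y)"
  shows "dir_deriv (\<lambda>z. h z (W z) (V z)) y X =
    Dh y X (W y) (V y) + h y (dir_deriv W y X) (V y) + h y (W y) (dir_deriv V y X)"
  by (rule dir_deriv_eqI, rule has_derivative_metric[where P = "\<lambda>z. z", OF assms(1) has_derivative_ident
    has_derivative_dir_deriv[OF assms(2)] has_derivative_dir_deriv[OF assms(3)]])

lemma metric_differentiable_along:
  assumes "y \<in> U" "W differentiable (at y)" "V differentiable (at y)"
  shows "(\<lambda>z. h z (W z) (V z)) differentiable (at y)"
  by (rule differentiableI, rule has_derivative_metric[where P = "\<lambda>z. z", OF assms(1) has_derivative_ident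
    has_derivative_dir_deriv[OF assms(2)] has_derivative_dir_deriv[OF assms(3)]])

text \<open>The musical isomorphism, with the cotangent space identified with the model space by its inner product.\<close>

definition flat :: "'e \<Rightarrow> 'e \<Rightarrow> 'e" where
  "flat y X = (\<Sum>b\<in>Basis. h y X b *\<^sub>R b)"

lemma flat_inner:
  assumes "y \<in> U" shows "flat y X \<bullet> Z = h y X Z"
proof -
  have r: "linear (h y X)" using bilin[OF assms] by (auto simp: bilinear_def)
  have "flat y X \<bullet> Z = (\<Sum>b\<in>Basis. (Z \<bullet> b) * h y X b)"
    by (simp add: flat_def inner_sum_left inner_commute[of Z] mult.commute)
  also have "\<dots> = h y X (\<Sum>b\<in>Basis. (Z \<bullet> b) *\<^sub>R b)"
    by (simp add: linear_sum[OF r] linear_scale[OF r])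
  finally show ?thesis by (simp add: euclidean_representation)
qed

lemma flat_linear: "y \<in> U \<Longrightarrow> linear (flat y)"
  by (rule linearI) (simp_all add: flat_def h_linear scaleR_add_left sum.distrib scaleR_sum_right)

lemma flat_inj: "y \<in> U \<Longrightarrow> inj (flat y)"
  by (rule injI, rule h_eqI) (auto simp flip: flat_inner)

lemma flat_surj: "y \<in> U \<Longrightarrow> surj (flat y)"
  by (simp add: flat_inj flat_linear linear_injective_imp_surjective)

lemma riesz:
  assumes "y \<in> U" "linear \<phi>" shows "\<exists>W. \<forall>Z. h y W Z = \<phi> Z"
proof -
  obtain W where W: "flat y W = (\<Sum>b\<in>Basis. \<phi> b *\<^sub>R b)"
    using flat_surj[OF assms(1)] by (metis surjD)
  have "h y W Z = \<phi> Z" for Z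
  proof -
    have "h y W Z = (\<Sum>b\<in>Basis. (Z \<bullet> b) * \<phi> b)"
      by (simp add: flat_inner[OF assms(1), symmetric] W inner_sum_left inner_commute[of Z] mult.commute)
    also have "\<dots> = \<phi> (\<Sum>b\<in>Basis. (Z \<bullet> b) *\<^sub>R b)"
      by (simp add: linear_sum[OF assms(2)] linear_scale[OF assms(2)])
    finally show ?thesis by (simp add: euclidean_representation)
  qed
  then show ?thesis by blast
qed

abbreviation \<Gamma> :: "'e \<Rightarrow> 'e \<Rightarrow> 'e \<Rightarrow> 'e" where
  "\<Gamma> y X Y \<equiv> christoffel h y X Y"

lemma koszul_ex:
  assumes y: "y \<in> U"
  shows "\<exists>W. \<forall>Z. 2 * h y W Z = Dh y X Y Z + Dh y Y X Z - Dh y Z X Y"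
proof -
  have "linear (\<lambda>Z. (Dh y X Y Z + Dh y Y X Z - Dh y Z X Y) / 2)"
    by (rule linearI)
     (simp_all add: bilinear_radd[OF Dh_bilinear[OF y]] bilinear_rmul[OF Dh_bilinear[OF y]]
      linear_add[OF Dh_linear[OF y]] linear_scale[OF Dh_linear[OF y]] field_simps)
  from riesz[OF y this] show ?thesis by (auto simp: field_simps)
qed

lemma koszul:
  assumes y: "y \<in> U"
  shows "2 * h y (\<Gamma> y X Y) Z = Dh y X Y Z + Dh y Y X Z - Dh y Z X Y"
proof -
  obtain W where W: "\<forall>Z. 2 * h y W Z = Dh y X Y Z + Dh y Y X Z - Dh y Z X Y"
    using koszul_ex[OF y] by blast
  have "\<forall>Z. 2 * h y (\<Gamma> y X Y) Z = Dh y X Y Z + Dh y Y X Z - Dh y Z X Y"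
    unfolding christoffel_def
  proof (rule theI[where P = "\<lambda>W. \<forall>Z. 2 * h y W Z = Dh y X Y Z + Dh y Y X Z - Dh y Z X Y", OF W])
    fix W' assume W': "\<forall>Z. 2 * h y W' Z = Dh y X Y Z + Dh y Y X Z - Dh y Z X Y"
    show "W' = W"
    proof (rule h_eqI[OF y])
      fix Z show "h y W' Z = h y W Z" using W[rule_format, of Z] W'[rule_format, of Z] by simp
    qed
  qed
  then show ?thesis by blast
qed

lemma christoffel_eqI:
  assumes "y \<in> U" "\<And>Z. 2 * h y W Z = Dh y X Y Z + Dh y Y X Z - Dh y Z X Y"
  shows "\<Gamma> y X Y = W"
proof (rule h_eqI[OF assms(1)])
  fix Z show "h y (\<Gamma> y X Y) Z = h y W Z"
    using koszul[OF assms(1), of X Y Z] assms(2)[of Z] by simp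
qed

lemma christoffel_sym: "y \<in> U \<Longrightarrow> \<Gamma> y X Y = \<Gamma> y Y X"
  by (rule christoffel_eqI) (auto simp: koszul Dh_sym[where X = X and Y = Y])

lemma christoffel_linear_right:
  assumes y: "y \<in> U" shows "linear (\<Gamma> y X)"
proof (rule linearI; rule christoffel_eqI[OF y])
  note Dh_lin = bilinear_ladd[OF Dh_bilinear[OF y]] bilinear_lmul[OF Dh_bilinear[OF y]]
    bilinear_radd[OF Dh_bilinear[OF y]] bilinear_rmul[OF Dh_bilinear[OF y]]
    linear_add[OF Dh_linear[OF y]] linear_scale[OF Dh_linear[OF y]]
  fix Y Y' Z and a :: real
  show "2 * h y (\<Gamma> y X Y + \<Gamma> y X Y') Z =
      Dh y X (Y + Y') Z + Dh y (Y + Y') X Z - Dh y Z X (Y + Y')"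
    using koszul[OF y, of X Y Z] koszul[OF y, of X Y' Z] by (simp add: h_linear[OF y] Dh_lin)
  show "2 * h y (a *\<^sub>R \<Gamma> y X Y) Z =
      Dh y X (a *\<^sub>R Y) Z + Dh y (a *\<^sub>R Y) X Z - Dh y Z X (a *\<^sub>R Y)"
    using arg_cong[OF koszul[OF y, of X Y Z], of "\<lambda>t. a * t"]
    by (simp add: h_linear[OF y] Dh_lin algebra_simps)
qed

lemma christoffel_linear_left: "y \<in> U \<Longrightarrow> linear (\<lambda>X. \<Gamma> y X Y)"
  using christoffel_linear_right[of y Y] by (simp only: christoffel_sym[of y Y])

lemma christoffel_linear:
  assumes "y \<in> U"
  shows "\<Gamma> y (X + X') Y = \<Gamma> y X Y + \<Gamma> y X' Y" "\<Gamma> y X (Y + Y') = \<Gamma> y X Y + \<Gamma> y X Y'"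
    "\<Gamma> y (a *\<^sub>R X) Y = a *\<^sub>R \<Gamma> y X Y" "\<Gamma> y X (a *\<^sub>R Y) = a *\<^sub>R \<Gamma> y X Y"
    "\<Gamma> y (- X) Y = - \<Gamma> y X Y" "\<Gamma> y X (- Y) = - \<Gamma> y X Y"
    "\<Gamma> y 0 Y = 0" "\<Gamma> y X 0 = 0"
  by (rule linear_add[OF christoffel_linear_left[OF assms]] linear_add[OF christoffel_linear_right[OF assms]]
    linear_scale[OF christoffel_linear_left[OF assms]] linear_scale[OF christoffel_linear_right[OF assms]]
    linear_neg[OF christoffel_linear_left[OF assms]] linear_neg[OF christoffel_linear_right[OF assms]]
    linear_0[OF christoffel_linear_left[OF assms]] linear_0[OF christoffel_linear_right[OF assms]])+

lemma metric_compatible: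
  assumes y: "y \<in> U"
  shows "Dh y X Y Z = h y (\<Gamma> y X Y) Z + h y Y (\<Gamma> y X Z)"
proof -
  have "Dh y X Z Y = Dh y X Y Z" "Dh y Y X Z = Dh y Y Z X" "Dh y Z X Y = Dh y Z Y X"
    by (rule Dh_sym[OF y])+
  then show ?thesis
    using koszul[OF y, of X Y Z] koszul[OF y, of X Z Y] sym[OF y, of Y "\<Gamma> y X Z"] by linarith
qed

text \<open>The Levi-Civita connection is the only torsion-free metric connection.\<close>

lemma christoffel_unique:
  assumes y: "y \<in> U" and s: "\<And>X Y. C X Y = C Y X"
    and c: "\<And>X Y Z. Dh y X Y Z = h y (C X Y) Z + h y Y (C X Z)"
  shows "\<Gamma> y X Y = C X Y"
proof (rule christoffel_eqI[OF y])
  fix Z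
  have "h y (C Z X) Y = h y Y (C X Z)" "h y X (C Z Y) = h y X (C Y Z)" "h y (C Y X) Z = h y (C X Y) Z"
    using s sym[OF y] by metis+
  then show "2 * h y (C X Y) Z = Dh y X Y Z + Dh y Y X Z - Dh y Z X Y"
    using c[where X = X and Y = Y and Z = Z] c[where X = Y and Y = X and Z = Z]
      c[where X = Z and Y = X and Z = Y] by linarith
qed

text \<open>The Christoffel map solves the linear system \<open>flat z W = r z\<close> with differentiable coefficients. Differentiability of
the solution follows from the inverse function theorem for \<open>(z, W) \<mapsto> (z, flat z W)\<close>, which is globally
injective over the chart, so that an inverse is given and no continuity of it has to be known in advance.\<close>

lemma christoffel_differentiable:
  assumes y: "y \<in> U"
  shows "(\<lambda>z. \<Gamma> z X Y) differentiable (at y)"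
proof -
  define F where "F p = (fst p, flat (fst p) (snd p))" for p
  define W where "W = \<Gamma> y X Y"
  define F' where "F' v = (fst v, \<Sum>b\<in>Basis. (Dh y (fst v) W b + h y (snd v) b) *\<^sub>R b)" for v
  define r where "r z = (\<Sum>b\<in>Basis. ((Dh z X Y b + Dh z Y X b - Dh z b X Y) / 2) *\<^sub>R b)" for z
  have der: "(F has_derivative (\<lambda>v. (fst v, \<Sum>b\<in>Basis.
      (Dh (fst p) (fst v) (snd p) b + h (fst p) (snd v) b) *\<^sub>R b))) (at p)" if "fst p \<in> U" for p
  proof -
    have "((\<lambda>p. h (fst p) (snd p) b) has_derivative
        (\<lambda>v. Dh (fst p) (fst v) (snd p) b + h (fst p) (snd v) b)) (at p)" for b
      using has_derivative_metric[where P = fst and W = snd and V = "\<lambda>_. b" and x = p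
          and P' = fst and W' = snd and V' = "\<lambda>_. 0"] that
      by (simp add: h_linear has_derivative_fst has_derivative_snd)
    then show ?thesis
      unfolding F_def[abs_def] flat_def
      by (intro has_derivative_Pair has_derivative_fst has_derivative_sum
          has_derivative_scaleR_left has_derivative_ident)
  qed
  have F': "(F has_derivative F') (at (y, W))"
    using der[of "(y, W)"] y by (simp add: F'_def[abs_def])
  then have lin: "linear F'"
    by (rule has_derivative_linear)
  have "inj F'"
  proof (rule linear_injective_0[OF lin, THEN iffD2], intro allI impI)
    fix v assume v: "F' v = 0"
    then have f: "fst v = 0" by (simp add: F'_def zero_prod_def)
    then have "Dh y (fst v) W b = 0" for b using linear_0[OF Dh_linear[OF y]] by simp
    then have "flat y (snd v) = 0" using v by (simp add: F'_def zero_prod_def flat_def)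
    then have "snd v = 0"
      using flat_inj[OF y] linear_0[OF flat_linear[OF y]] by (metis injD)
    then show "v = 0" using f by (simp add: prod_eq_iff)
  qed
  then have "surj F'" using lin by (simp add: linear_injective_imp_surjective)
  then obtain G' where G': "F' \<circ> G' = id"
    using linear_surjective_right_inverse[OF lin] by blast
  define gi where "gi = inv_into (U \<times> UNIV) F"
  have "inj_on F (U \<times> UNIV)"
  proof (rule inj_onI)
    fix p q assume "p \<in> U \<times> UNIV" "F p = F q"
    then have "fst p \<in> U" "fst p = fst q" "flat (fst p) (snd p) = flat (fst p) (snd q)"
      by (auto simp: F_def)
    then show "p = q" using injD[OF flat_inj[of "fst p"], of "snd p" "snd q"] by (simp add: prod_eq_iff)
  qed
  then have gi: "gi (F p) = p" if "p \<in> U \<times> UNIV" for p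
    using that by (simp add: gi_def)
  have "continuous_on (U \<times> UNIV) F"
    by (intro continuous_at_imp_continuous_on ballI has_derivative_continuous[OF der]) auto
  then have "(gi has_derivative G') (at (F (y, W)))"
    by (rule has_derivative_inverse_strong[rotated 2, OF _ gi F' G'])
      (use y open_U in \<open>auto intro: open_Times\<close>)
  moreover have Fr: "F (z, \<Gamma> z X Y) = (z, r z)" if "z \<in> U" for z
    using koszul[OF that, of X Y, symmetric] by (simp add: F_def r_def flat_def)
  ultimately have "(gi has_derivative G') (at (y, r y))" using y by (simp add: W_def)
  moreover have "(\<lambda>z. (z, r z)) differentiable (at y)"
  proof -
    have "(\<lambda>z. (Dh z X Y b + Dh z Y X b - Dh z b X Y) / 2) differentiable (at y)" for b
      by (intro differentiable_divide differentiable_add differentiable_diff Dh_differentiable y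
          differentiable_const) simp
    then have "r differentiable (at y)"
      unfolding r_def[abs_def] by (intro differentiable_sum ballI differentiable_scaleR differentiable_const) auto
    then show ?thesis
      using has_derivative_Pair[OF has_derivative_ident has_derivative_dir_deriv]
      unfolding differentiable_def by blast
  qed
  ultimately have "(\<lambda>z. gi (z, r z)) differentiable (at y)"
    using differentiable_chain_at[of "\<lambda>z. (z, r z)" y gi] by (auto simp: differentiable_def o_def)
  then have "(\<lambda>z. snd (gi (z, r z))) differentiable (at y)"
    unfolding differentiable_def by (auto intro: has_derivative_snd)
  moreover have "snd (gi (z, r z)) = \<Gamma> z X Y" if "z \<in> U" for z
    using gi[of "(z, \<Gamma> z X Y)"] that by (simp add: Fr)
  ultimately show ?thesis
    using differentiable_cong_open[OF open_U y, of "\<lambda>z. snd (gi (z, r z))" "\<lambda>z. \<Gamma> z X Y"] by simp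
qed

text \<open>The Koszul formula, differentiated once: it expresses derivatives of the Christoffel map by second
derivatives of the metric.\<close>

lemma koszul_deriv:
  assumes y: "y \<in> U"
  shows "2 * h y (dir_deriv (\<lambda>z. \<Gamma> z X Y) y V) Z + 2 * Dh y V (\<Gamma> y X Y) Z =
     D2h y V X Y Z + D2h y V Y X Z - D2h y V Z X Y"
proof -
  have 1: "dir_deriv (\<lambda>z. h z (\<Gamma> z X Y) Z) y V =
      Dh y V (\<Gamma> y X Y) Z + h y (dir_deriv (\<lambda>z. \<Gamma> z X Y) y V) Z"
    using dir_deriv_metric[OF y christoffel_differentiable[OF y] differentiable_const, of X Y Z V]
    by (simp add: h_linear(10)[OF y])
  have "dir_deriv (\<lambda>z. 2 * h z (\<Gamma> z X Y) Z) y V = 2 * dir_deriv (\<lambda>z. h z (\<Gamma> z X Y) Z) y V"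
    by (rule dir_deriv_eqI, intro has_derivative_mult_right has_derivative_dir_deriv
      metric_differentiable_along y christoffel_differentiable differentiable_const)
  then have "2 * h y (dir_deriv (\<lambda>z. \<Gamma> z X Y) y V) Z + 2 * Dh y V (\<Gamma> y X Y) Z =
    dir_deriv (\<lambda>z. 2 * h z (\<Gamma> z X Y) Z) y V" unfolding 1 by (simp only: distrib_left add.commute)
  also have "\<dots> = dir_deriv (\<lambda>z. Dh z X Y Z + Dh z Y X Z - Dh z Z X Y) y V"
    by (rule dir_deriv_cong_open[OF open_U y]) (rule koszul)
  also have "\<dots> = D2h y V X Y Z + D2h y V Y X Z - D2h y V Z X Y"
    by (rule dir_deriv_eqI)
      (intro has_derivative_add has_derivative_diff has_derivative_dir_deriv Dh_differentiable y)
  finally show ?thesis .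
qed

text \<open>Differentiating the compatibility of connection and metric once more and antisymmetrizing in the two
directions leaves only curvature terms.\<close>

lemma curvature_skew:
  assumes y: "y \<in> U"
  shows "h y (curvature h y X Y W) V = - h y (curvature h y X Y V) W"
proof -
  have D: "D2h y X Y W V = h y (\<Gamma> y X (\<Gamma> y Y W)) V + h y (\<Gamma> y Y W) (\<Gamma> y X V)
      + h y (dir_deriv (\<lambda>z. \<Gamma> z Y W) y X) V + h y (\<Gamma> y X W) (\<Gamma> y Y V)
      + h y W (\<Gamma> y X (\<Gamma> y Y V)) + h y W (dir_deriv (\<lambda>z. \<Gamma> z Y V) y X)" for X Y W V
  proof -
    have "D2h y X Y W V = dir_deriv (\<lambda>z. h z (\<Gamma> z Y W) V + h z W (\<Gamma> z Y V)) y X"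
      by (rule dir_deriv_cong_open[OF open_U y], rule metric_compatible, assumption)
    also have "\<dots> = dir_deriv (\<lambda>z. h z (\<Gamma> z Y W) V) y X + dir_deriv (\<lambda>z. h z W (\<Gamma> z Y V)) y X"
      by (rule dir_deriv_eqI) (intro has_derivative_add has_derivative_dir_deriv metric_differentiable_along
          christoffel_differentiable y differentiable_const)
    also have "\<dots> = Dh y X (\<Gamma> y Y W) V + h y (dir_deriv (\<lambda>z. \<Gamma> z Y W) y X) V
       + (Dh y X W (\<Gamma> y Y V) + h y W (dir_deriv (\<lambda>z. \<Gamma> z Y V) y X))"
      using dir_deriv_metric[OF y christoffel_differentiable[OF y], of "\<lambda>_. V"]
        dir_deriv_metric[OF y _ christoffel_differentiable[OF y], of "\<lambda>_. W"]
      by (simp add: h_linear y)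
    finally show ?thesis by (simp add: metric_compatible[OF y])
  qed
  have "D2h y X Y W V - D2h y Y X W V = 0" using D2h_commute[OF y] by simp
  then have "h y (curvature h y X Y W) V + h y W (curvature h y X Y V) = 0"
    unfolding D curvature_def by (simp add: h_linear y sym[OF y, of "\<Gamma> y Y W" "\<Gamma> y X V"]
        sym[OF y, of "\<Gamma> y X W" "\<Gamma> y Y V"])
  then show ?thesis using sym[OF y, of W] by simp
qed

text \<open>The trace is taken in the basis of the model space, which is not adapted to the metric. Expressed with the dual
basis \<open>d\<close> it is the contraction of a symmetric with an antisymmetric array.\<close>

lemma trace_skew:
  assumes y: "y \<in> U" and T: "\<And>W V. h y (T W) V = - h y (T V) W"
  shows "(\<Sum>b\<in>Basis. T b \<bullet> b) = 0"
proof -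
  obtain d where d: "\<And>b. flat y (d b) = b"
    using flat_surj[OF y] by (metis surjD)
  have hd: "h y (d b) Z = b \<bullet> Z" for b Z
    by (simp add: flat_inner[OF y, symmetric] d)
  define m where "m b c = d b \<bullet> c" for b c
  have m: "m b c = m c b" for b c
    using hd[of c "d b"] hd[of b "d c"] sym[OF y, of "d b" "d c"] by (simp add: m_def inner_commute)
  have r: "linear (h y X)" for X using bilin[OF y] by (auto simp: bilinear_def)
  have tr: "T b \<bullet> b = (\<Sum>c\<in>Basis. m b c * h y (T b) c)" for b
  proof -
    have "T b \<bullet> b = h y (T b) (d b)"
      by (simp add: sym[OF y, of "T b"] hd inner_commute)
    also have "\<dots> = h y (T b) (\<Sum>c\<in>Basis. (d b \<bullet> c) *\<^sub>R c)"
      by (simp add: euclidean_representation)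
    also have "\<dots> = (\<Sum>c\<in>Basis. m b c * h y (T b) c)"
      by (simp add: linear_sum[OF r] linear_scale[OF r] m_def)
    finally show ?thesis .
  qed
  have "(\<Sum>b\<in>Basis. T b \<bullet> b) = (\<Sum>b\<in>Basis. \<Sum>c\<in>Basis. m b c * h y (T b) c)"
    by (simp add: tr)
  also have "\<dots> = (\<Sum>c\<in>Basis. \<Sum>b\<in>Basis. m b c * h y (T b) c)" by (rule sum.swap)
  also have "\<dots> = (\<Sum>c\<in>Basis. \<Sum>b\<in>Basis. - (m c b * h y (T c) b))"
    by (intro sum.cong refl) (metis T m mult_minus_right)
  also have "\<dots> = - (\<Sum>b\<in>Basis. T b \<bullet> b)"
    by (simp add: tr sum_negf)
  finally show ?thesis by simp
qed

lemma curvature_trace: "y \<in> U \<Longrightarrow> (\<Sum>b\<in>Basis. curvature h y X Y b \<bullet> b) = 0"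
  by (rule trace_skew) (auto intro: curvature_skew)

end

text \<open>The transformation law of the Christoffel symbols. Pulling back the Koszul formula, the six terms
with second derivatives of \<open>f\<close> reduce to twice a single one, as second derivatives are symmetric.\<close>

lemma christoffel_transform:
  assumes g: "local_metric U g" and g': "local_metric U' g'"
    and S: "open S" "S \<subseteq> U" and f: "smooth_on S f" "\<And>z. z \<in> S \<Longrightarrow> f z \<in> U'"
    and pullback: "\<And>z X Y. z \<in> S \<Longrightarrow> g z X Y = g' (f z) (dir_deriv f z X) (dir_deriv f z Y)"
    and z: "z \<in> S" and surj: "surj (dir_deriv f z)"
  shows "dir_deriv f z (christoffel g z X Y) =
    christoffel g' (f z) (dir_deriv f z X) (dir_deriv f z Y) + dir_deriv (\<lambda>z. dir_deriv f z X) z Y"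
proof -
  interpret g: local_metric U g by fact
  interpret g': local_metric U' g' by fact
  let ?D = "\<lambda>X. dir_deriv f z X" and ?H = "\<lambda>X Y. dir_deriv (\<lambda>z. dir_deriv f z X) z Y"
  have zU: "z \<in> U" and fz: "f z \<in> U'" using S f z by auto
  have H: "?H X Y = ?H Y X" for X Y by (rule dir_deriv_commute[OF S(1) z f(1)])
  have Dg: "g.Dh z V X Y = g'.Dh (f z) (?D V) (?D X) (?D Y) + g' (f z) (?H X V) (?D Y) + g' (f z) (?D X) (?H Y V)" for V X Y
  proof -
    have "g.Dh z V X Y = dir_deriv (\<lambda>z. g' (f z) (dir_deriv f z X) (dir_deriv f z Y)) z V"
      by (rule dir_deriv_cong_open[OF S(1) z]) (rule pullback)
    also have "\<dots> = g'.Dh (f z) (?D V) (?D X) (?D Y) + g' (f z) (?H X V) (?D Y) + g' (f z) (?D X) (?H Y V)"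
      by (rule dir_deriv_eqI)
        (intro g'.has_derivative_metric fz has_derivative_dir_deriv smooth_on_differentiable[OF _ z]
          smooth_on_dir_deriv f(1))
    finally show ?thesis .
  qed
  show ?thesis
  proof (rule g'.h_eqI[OF fz])
    fix V
    obtain Z where V: "V = ?D Z" using surj by (metis surjD)
    have s: "g' (f z) A B = g' (f z) B A" for A B by (rule g'.sym[OF fz])
    have "2 * g' (f z) (?D (christoffel g z X Y)) V = 2 * g z (christoffel g z X Y) Z"
      unfolding V pullback[OF z] ..
    also have "\<dots> = g.Dh z X Y Z + g.Dh z Y X Z - g.Dh z Z X Y" by (rule g.koszul[OF zU])
    also have "\<dots> = 2 * g' (f z) (christoffel g' (f z) (?D X) (?D Y)) (?D Z) + 2 * g' (f z) (?H X Y) (?D Z)"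
      unfolding g'.koszul[OF fz] Dg H[of Z X] H[of Z Y] H[of Y X] s[of "?D Y" "?H X Z"]
      by simp
    finally show "g' (f z) (?D (christoffel g z X Y)) V =
        g' (f z) (christoffel g' (f z) (?D X) (?D Y) + ?H X Y) V"
      by (simp add: V g'.h_linear[OF fz])
  qed
qed

section \<open>A natural metric near the zero section, in an induced chart\<close>

text \<open>Here \<open>(X, W)\<close> is the vector with components \<open>X\<close> in the base and \<open>W\<close> in the fibre; its vertical part is
\<open>K = W + \<Gamma>(u, X)\<close>, so the last assumption says that \<open>G\<close> is the natural metric with horizontal
coefficients \<open>a, p\<close>, mixed coefficients \<open>b, q\<close> and vertical coefficients \<open>c, s\<close>.\<close>

locale natural_metric_in_chart =
  base: local_metric U g + total: local_metric "U \<times> UNIV" G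
  for U :: "'e::euclidean_space set" and g :: "'e \<Rightarrow> 'e \<Rightarrow> 'e \<Rightarrow> real"
    and G :: "'e \<times> 'e \<Rightarrow> 'e \<times> 'e \<Rightarrow> 'e \<times> 'e \<Rightarrow> real" +
  fixes a b c p q s :: "real \<Rightarrow> real"
  assumes smooth_coeffs: "f \<in> {a, b, c, p, q, s} \<Longrightarrow> smooth_on UNIV f"
    and G_eq: "y \<in> U \<Longrightarrow> t = g y u u \<Longrightarrow> K = W + christoffel g y u X \<Longrightarrow> L = V + christoffel g y u Y \<Longrightarrow>
      G (y, u) (X, W) (Y, V) = a t * g y X Y + p t * g y X u * g y Y u
        + b t * g y X L + q t * g y X u * g y L u + b t * g y K Y + q t * g y K u * g y Y u
        + c t * g y K L + s t * g y K u * g y L u"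
begin

lemma G_zero:
  "y \<in> U \<Longrightarrow> G (y, 0) (X, W) (Y, V) = a 0 * g y X Y + b 0 * (g y X V + g y W Y) + c 0 * g y W V"
  by (subst G_eq[OF _ refl refl refl])
    (simp_all add: base.h_linear base.christoffel_linear distrib_left)

lemma G_vertical_line:
  assumes y: "y \<in> U"
  shows "((\<lambda>r. G (y, r *\<^sub>R W) \<xi> \<eta>) has_real_derivative total.Dh (y, r *\<^sub>R W) (0, W) \<xi> \<eta>) (at r)"
    and "((\<lambda>r. total.Dh (y, r *\<^sub>R W) \<zeta> \<xi> \<eta>) has_real_derivative
      total.D2h (y, r *\<^sub>R W) (0, W) \<zeta> \<xi> \<eta>) (at r)"
  by (intro has_real_derivative_fibre_line total.metric_differentiable total.Dh_differentiable; simp add: y)+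

text \<open>Of the 1-jet of \<open>G\<close> in fibre directions only the constants \<open>b 0\<close> and \<open>c 0\<close> survive at the zero
section: the other contributions have a factor of degree at least 2 in the fibre variable.\<close>

lemma Dh_vertical:
  assumes y: "y \<in> U"
  shows "total.Dh (y, 0) (0, W) (Y, V) (Z, S) =
    b 0 * (g y Y (christoffel g y W Z) + g y (christoffel g y W Y) Z)
    + c 0 * (g y V (christoffel g y W Z) + g y (christoffel g y W Y) S)"
proof -
  define \<tau> where "\<tau> = g y W W"
  let ?A = "christoffel g y W Y" and ?B = "christoffel g y W Z"
  have G: "G (y, r *\<^sub>R W) (Y, V) (Z, S) = a (r\<^sup>2 * \<tau>) * g y Y Z + p (r\<^sup>2 * \<tau>) * (r\<^sup>2 * (g y Y W * g y Z W))
      + b (r\<^sup>2 * \<tau>) * (g y Y S + r * g y Y ?B)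
      + q (r\<^sup>2 * \<tau>) * (r\<^sup>2 * (g y Y W * (g y S W + r * g y ?B W)))
      + b (r\<^sup>2 * \<tau>) * (g y V Z + r * g y ?A Z)
      + q (r\<^sup>2 * \<tau>) * (r\<^sup>2 * ((g y V W + r * g y ?A W) * g y Z W))
      + c (r\<^sup>2 * \<tau>) * (g y V S + r * g y V ?B + r * g y ?A S + r\<^sup>2 * g y ?A ?B)
      + s (r\<^sup>2 * \<tau>) * (r\<^sup>2 * ((g y V W + r * g y ?A W) * (g y S W + r * g y ?B W)))" for r
    by (subst G_eq[OF y, of "r\<^sup>2 * \<tau>", OF _ refl refl])
      (simp_all add: \<tau>_def base.h_linear[OF y] base.christoffel_linear[OF y] power2_eq_square algebra_simps)
  have "((\<lambda>r. G (y, r *\<^sub>R W) (Y, V) (Z, S)) has_real_derivative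
      a 0 * 0 + p 0 * 0 + b 0 * (0 + g y Y ?B) + q 0 * 0 + b 0 * (0 + g y ?A Z) + q 0 * 0
      + c 0 * (0 + g y V ?B + g y ?A S + 0) + s 0 * 0) (at 0)"
    unfolding G
    by (intro DERIV_add has_derivative_even_coefficient smooth_coeffs; (auto intro!: derivative_eq_intros)?)
  from DERIV_unique[OF this] G_vertical_line(1)[OF y, where r = 0 and W = W and \<xi> = "(Y, V)" and \<eta> = "(Z, S)"]
  show ?thesis by (simp add: distrib_left)
qed

lemma Dh_horizontal:
  assumes y: "y \<in> U"
  shows "total.Dh (y, 0) (T, 0) (Y, V) (Z, S) =
    a 0 * base.Dh y T Y Z + b 0 * (base.Dh y T Y S + base.Dh y T V Z) + c 0 * base.Dh y T V S"
proof -
  have "total.Dh (y, 0) (T, 0) (Y, V) (Z, S) = dir_deriv (\<lambda>y. G (y, 0) (Y, V) (Z, S)) y T"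
    by (rule dir_deriv_zero_slice[symmetric], rule total.metric_differentiable) (simp add: y)
  also have "\<dots> = dir_deriv (\<lambda>y. a 0 * g y Y Z + b 0 * (g y Y S + g y V Z) + c 0 * g y V S) y T"
    by (rule dir_deriv_cong_open[OF base.open_U y]) (rule G_zero)
  also have "\<dots> = a 0 * base.Dh y T Y Z + b 0 * (base.Dh y T Y S + base.Dh y T V Z) + c 0 * base.Dh y T V S"
    by (rule dir_deriv_eqI)
      (intro has_derivative_add has_derivative_mult_right has_derivative_dir_deriv
        base.metric_differentiable y)
  finally show ?thesis .
qed

lemma Dh_split:
  assumes y: "y \<in> U"
  shows "total.Dh (y, 0) (T, W) \<xi> \<eta> = total.Dh (y, 0) (T, 0) \<xi> \<eta> + total.Dh (y, 0) (0, W) \<xi> \<eta>"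
proof -
  have "linear (\<lambda>V. total.Dh (y, 0) V \<xi> \<eta>)" by (rule total.Dh_linear) (simp add: y)
  from linear_add[OF this, of "(T, 0)" "(0, W)"] show ?thesis by simp
qed

text \<open>The right hand side is symmetric, and metric by the first derivatives of \<open>G\<close> just computed. It is
independent of the coefficients of \<open>G\<close>; in particular the zero section is totally geodesic.\<close>

lemma christoffel_zero_section:
  assumes y: "y \<in> U"
  shows "christoffel G (y, 0) (X, W) (Y, V) =
    (christoffel g y X Y, christoffel g y X V + christoffel g y W Y)"
proof -
  define C where "C \<xi> \<eta> = (case (\<xi>, \<eta>) of ((X, W), (Y, V)) \<Rightarrow>
    (christoffel g y X Y, christoffel g y X V + christoffel g y W Y))" for \<xi> \<eta>
  have "christoffel G (y, 0) \<xi> \<eta> = C \<xi> \<eta>" for \<xi> \<eta>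
  proof (rule total.christoffel_unique)
    show "(y, 0) \<in> U \<times> UNIV" using y by simp
    fix \<xi> \<eta> \<zeta> :: "'e \<times> 'e"
    obtain X W Y V T S where *: "\<xi> = (X, W)" "\<eta> = (Y, V)" "\<zeta> = (T, S)"
      by (metis surj_pair)
    show "C \<xi> \<eta> = C \<eta> \<xi>"
      unfolding * C_def prod.case
      by (simp add: base.christoffel_sym[OF y, of X] base.christoffel_sym[OF y, of W] add.commute)
    show "total.Dh (y, 0) \<xi> \<eta> \<zeta> = G (y, 0) (C \<xi> \<eta>) \<zeta> + G (y, 0) \<eta> (C \<xi> \<zeta>)"
      unfolding * C_def prod.case
      by (subst Dh_split[OF y], unfold Dh_horizontal[OF y] Dh_vertical[OF y]
        G_zero[OF y] base.metric_compatible[OF y]) (simp add: base.h_linear[OF y] distrib_left)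
  qed
  then show ?thesis by (simp add: C_def)
qed

text \<open>Exchanging the two derivatives reduces this to the derivative along the zero section of the first fibre
derivatives, so \<open>G\<close> need not be differentiated in base directions off the zero section.\<close>

lemma D2h_vertical_horizontal:
  assumes y: "y \<in> U"
  shows "total.D2h (y, 0) (0, W) (T, 0) (Y, 0) (Z, S) =
    b 0 * base.D2h y T W Y Z
    + c 0 * (g y (christoffel g y T (christoffel g y W Y)) S
      + g y (christoffel g y W Y) (christoffel g y T S)
      + g y (dir_deriv (\<lambda>z. christoffel g z W Y) y T) S)"
proof -
  have "total.D2h (y, 0) (0, W) (T, 0) (Y, 0) (Z, S) = total.D2h (y, 0) (T, 0) (0, W) (Y, 0) (Z, S)"
    by (rule total.D2h_commute) (simp add: y)
  also have "\<dots> = dir_deriv (\<lambda>y. total.Dh (y, 0) (0, W) (Y, 0) (Z, S)) y T"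
    by (rule dir_deriv_zero_slice[symmetric], rule total.Dh_differentiable) (simp add: y)
  also have "\<dots> = dir_deriv (\<lambda>y. b 0 * base.Dh y W Y Z + c 0 * g y (christoffel g y W Y) S) y T"
    by (rule dir_deriv_cong_open[OF base.open_U y])
      (simp add: Dh_vertical base.metric_compatible base.h_linear algebra_simps)
  also have "\<dots> = b 0 * base.D2h y T W Y Z + c 0 * dir_deriv (\<lambda>y. g y (christoffel g y W Y) S) y T"
    by (rule dir_deriv_eqI)
      (intro has_derivative_add has_derivative_mult_right has_derivative_dir_deriv
        base.Dh_differentiable base.metric_differentiable_along base.christoffel_differentiable
        differentiable_const y)
  also have "dir_deriv (\<lambda>y. g y (christoffel g y W Y) S) y T =
      base.Dh y T (christoffel g y W Y) S + g y (dir_deriv (\<lambda>z. christoffel g z W Y) y T) S"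
    using base.dir_deriv_metric[OF y base.christoffel_differentiable[OF y] differentiable_const, of W Y S T]
    by (simp add: base.h_linear(10)[OF y])
  finally show ?thesis by (simp add: base.metric_compatible[OF y])
qed

lemma D2h_vertical_linear:
  assumes y: "y \<in> U"
  shows "linear (\<lambda>\<zeta>. total.D2h (y, 0) \<zeta> \<zeta>' \<xi> \<eta>)" "linear (\<lambda>\<zeta>. total.D2h (y, 0) \<zeta>' \<zeta> \<xi> \<eta>)"
proof -
  have y0: "(y, 0) \<in> U \<times> UNIV" using y by simp
  show *: "linear (\<lambda>\<zeta>. total.D2h (y, 0) \<zeta> \<zeta>' \<xi> \<eta>)" for \<zeta>'
    by (rule linear_frechet_derivative[OF total.Dh_differentiable[OF y0]])
  show "linear (\<lambda>\<zeta>. total.D2h (y, 0) \<zeta>' \<zeta> \<xi> \<eta>)"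
    using *[of \<zeta>'] by (subst total.D2h_commute[OF y0])
qed

text \<open>For equal fibre directions the Hessian is a second derivative along a line.\<close>

lemma D2h_vertical_diagonal:
  assumes y: "y \<in> U"
  shows "total.D2h (y, 0) (0, W) (0, W) (Y, 0) (Z, 0) =
    2 * deriv a 0 * g y W W * g y Y Z + 2 * p 0 * g y Y W * g y Z W
    + 2 * c 0 * g y (christoffel g y W Y) (christoffel g y W Z)"
proof -
  let ?A = "christoffel g y W Y" and ?B = "christoffel g y W Z"
  have "total.D2h (y, 0 *\<^sub>R W) (0, W) (0, W) (Y, 0) (Z, 0) =
      2 * g y W W * g y Y Z * deriv a 0 + 2 * g y ?A ?B * c 0 + 2 * (g y Y W * g y Z W) * p 0"
  proof (rule second_derivative_even_expansion[OF smooth_coeffs])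
    show "G (y, r *\<^sub>R W) (Y, 0) (Z, 0) =
      g y Y Z * a (r\<^sup>2 * g y W W) + (g y Y ?B + g y ?A Z) * r * b (r\<^sup>2 * g y W W)
      + g y ?A ?B * r\<^sup>2 * c (r\<^sup>2 * g y W W) + (g y Y W * g y Z W) * r\<^sup>2 * p (r\<^sup>2 * g y W W)
      + (g y Y W * g y ?B W + g y ?A W * g y Z W) * r ^ 3 * q (r\<^sup>2 * g y W W)
      + (g y ?A W * g y ?B W) * r ^ 4 * s (r\<^sup>2 * g y W W)" for r
      by (subst G_eq[OF y, of "r\<^sup>2 * g y W W", OF _ refl refl])
        (simp_all add: base.h_linear[OF y] base.christoffel_linear[OF y]
          power2_eq_square power3_eq_cube power4_eq_xxxx algebra_simps)
    show "((\<lambda>r. G (y, r *\<^sub>R W) (Y, 0) (Z, 0)) has_real_derivative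
        total.Dh (y, r *\<^sub>R W) (0, W) (Y, 0) (Z, 0)) (at r)" for r
      by (rule G_vertical_line[OF y])
    show "((\<lambda>r. total.Dh (y, r *\<^sub>R W) (0, W) (Y, 0) (Z, 0)) has_real_derivative
        total.D2h (y, 0 *\<^sub>R W) (0, W) (0, W) (Y, 0) (Z, 0)) (at 0)"
      by (rule G_vertical_line[OF y])
  qed
  then show ?thesis by simp
qed

text \<open>Polarization of the diagonal case.\<close>

lemma D2h_vertical_vertical:
  assumes y: "y \<in> U"
  shows "total.D2h (y, 0) (0, W) (0, S) (Y, 0) (Z, 0) =
    2 * deriv a 0 * g y W S * g y Y Z + p 0 * (g y Y W * g y Z S + g y Y S * g y Z W)
    + c 0 * (g y (christoffel g y W Y) (christoffel g y S Z) + g y (christoffel g y S Y) (christoffel g y W Z))"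
proof -
  let ?H = "\<lambda>W S. total.D2h (y, 0) (0, W) (0, S) (Y, 0) (Z, 0)"
  have "(0::'e, W + S) = (0, W) + (0, S)" by simp
  then have "?H (W + S) (W + S) = ?H W W + ?H W S + (?H S W + ?H S S)"
    by (simp only: linear_add[OF D2h_vertical_linear(1)[OF y]] linear_add[OF D2h_vertical_linear(2)[OF y]])
  moreover have "?H S W = ?H W S" by (rule total.D2h_commute) (simp add: y)
  ultimately have "2 * ?H W S = ?H (W + S) (W + S) - ?H W W - ?H S S" by simp
  then show ?thesis
    unfolding D2h_vertical_diagonal[OF y]
    by (simp add: base.h_linear[OF y] base.christoffel_linear[OF y] base.sym[OF y, of S W] algebra_simps)
qed

text \<open>Only derivatives along the zero section enter, where the connection restricts to that of \<open>g\<close>.\<close>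

lemma curvature_horizontal:
  assumes y: "y \<in> U"
  shows "fst (curvature G (y, 0) (X, 0) (Y, 0) (Z, 0)) = curvature g y X Y Z"
proof -
  have D: "dir_deriv (\<lambda>z. christoffel G z (Y, 0) (Z, 0)) (y, 0) (X, 0) =
      (dir_deriv (\<lambda>z. christoffel g z Y Z) y X, 0)" for X Y Z
  proof -
    have "dir_deriv (\<lambda>z. christoffel G z (Y, 0) (Z, 0)) (y, 0) (X, 0) =
        dir_deriv (\<lambda>y. christoffel G (y, 0) (Y, 0) (Z, 0)) y X"
      by (rule dir_deriv_zero_slice[symmetric], rule total.christoffel_differentiable) (simp add: y)
    also have "\<dots> = dir_deriv (\<lambda>y. (christoffel g y Y Z, 0::'e)) y X"
      by (rule dir_deriv_cong_open[OF base.open_U y])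
        (simp add: christoffel_zero_section base.christoffel_linear)
    also have "\<dots> = (dir_deriv (\<lambda>z. christoffel g z Y Z) y X, 0)"
      by (rule dir_deriv_eqI, rule has_derivative_Pair)
        (auto intro!: has_derivative_dir_deriv base.christoffel_differentiable y)
    finally show ?thesis .
  qed
  show ?thesis
    by (simp add: curvature_def D christoffel_zero_section[OF y])
qed

lemma curvature_vertical:
  assumes y: "y \<in> U"
  shows "snd (curvature G (y, 0) (0, W) (Y, 0) (Z, 0)) =
    snd (dir_deriv (\<lambda>z. christoffel G z (Y, 0) (Z, 0)) (y, 0) (0, W))
    - dir_deriv (\<lambda>z. christoffel g z W Z) y Y
    + christoffel g y W (christoffel g y Y Z) - christoffel g y Y (christoffel g y W Z)"
proof -
  have "dir_deriv (\<lambda>z. christoffel G z (0, W) (Z, 0)) (y, 0) (Y, 0) =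
      dir_deriv (\<lambda>y. christoffel G (y, 0) (0, W) (Z, 0)) y Y"
    by (rule dir_deriv_zero_slice[symmetric], rule total.christoffel_differentiable) (simp add: y)
  also have "\<dots> = dir_deriv (\<lambda>y. (0::'e, christoffel g y W Z)) y Y"
    by (rule dir_deriv_cong_open[OF base.open_U y])
      (simp add: christoffel_zero_section base.christoffel_linear)
  also have "\<dots> = (0, dir_deriv (\<lambda>z. christoffel g z W Z) y Y)"
    by (rule dir_deriv_eqI, rule has_derivative_Pair)
      (auto intro!: has_derivative_dir_deriv base.christoffel_differentiable y)
  finally have D: "dir_deriv (\<lambda>z. christoffel G z (0, W) (Z, 0)) (y, 0) (Y, 0) =
    (0, dir_deriv (\<lambda>z. christoffel g z W Z) y Y)" .
  show ?thesis
    by (simp add: curvature_def D christoffel_zero_section[OF y] base.christoffel_linear[OF y])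
qed

text \<open>The determinant of the coefficients of \<open>G\<close> at the zero section.\<close>

definition \<alpha> :: real where "\<alpha> = a 0 * c 0 - (b 0)\<^sup>2"

text \<open>Testing the differentiated Koszul formula against \<open>(- b S, a S)\<close> isolates the vertical component
of the unknown vector: up to the factor \<open>\<alpha>\<close> this is the second row of the inverse of the coefficient
matrix of \<open>G\<close>.\<close>

lemma koszul_fibre_derivative:
  fixes Y Z W S :: 'e
  assumes y: "y \<in> U"
  defines "\<Gamma> \<equiv> christoffel g y"
  defines "D \<equiv> \<lambda>V X Y. dir_deriv (\<lambda>z. christoffel g z X Y) y V"
  shows "2 * (\<alpha> * g y (snd (dir_deriv (\<lambda>z. christoffel G z (Y, 0) (Z, 0)) (y, 0) (0, W))) S) =
    - 2 * (b 0)\<^sup>2 * g y (D W Y Z) S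
    + a 0 * c 0 * (g y (D Y W Z) S + g y (\<Gamma> Y (\<Gamma> W Z)) S
      + g y (D Z W Y) S + g y (\<Gamma> Z (\<Gamma> W Y)) S - 2 * g y (\<Gamma> W (\<Gamma> Y Z)) S)
    - a 0 * (2 * deriv a 0 * g y W S * g y Y Z + p 0 * (g y Y W * g y Z S + g y Y S * g y Z W))"
proof -
  let ?L = "dir_deriv (\<lambda>z. christoffel G z (Y, 0) (Z, 0)) (y, 0) (0, W)"
  let ?\<zeta> = "((- b 0) *\<^sub>R S, a 0 *\<^sub>R S)"
  let ?b = "b 0" and ?a = "a 0" and ?c = "c 0"
  have y0: "(y, 0) \<in> U \<times> UNIV" using y by simp
  note lin = base.h_linear[OF y] base.christoffel_linear[OF y]
  note bDh = base.Dh_bilinear[OF y]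
  have K: "2 * G (y, 0) ?L ?\<zeta> + 2 * total.Dh (y, 0) (0, W) (christoffel G (y, 0) (Y, 0) (Z, 0)) ?\<zeta> =
      total.D2h (y, 0) (0, W) (Y, 0) (Z, 0) ?\<zeta> + total.D2h (y, 0) (0, W) (Z, 0) (Y, 0) ?\<zeta>
      - total.D2h (y, 0) (0, W) ?\<zeta> (Y, 0) (Z, 0)"
    by (rule total.koszul_deriv[OF y0])
  have 1: "G (y, 0) ?L ?\<zeta> = \<alpha> * g y (snd ?L) S"
    using G_zero[OF y, of "fst ?L" "snd ?L" "(- b 0) *\<^sub>R S" "a 0 *\<^sub>R S"]
    by (simp add: lin \<alpha>_def power2_eq_square algebra_simps)
  have 2: "total.Dh (y, 0) (0, W) (christoffel G (y, 0) (Y, 0) (Z, 0)) ?\<zeta> =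
      - ?b\<^sup>2 * base.Dh y W (\<Gamma> Y Z) S + ?a * ?c * g y (\<Gamma> W (\<Gamma> Y Z)) S"
    unfolding christoffel_zero_section[OF y] Dh_vertical[OF y] base.metric_compatible[OF y] \<Gamma>_def
    by (simp add: lin power2_eq_square algebra_simps)
  have D2_scale: "base.D2h y V X Y (t *\<^sub>R S) = t * base.D2h y V X Y S" for V X Y t
  proof -
    have "base.D2h y V X Y (t *\<^sub>R S) = dir_deriv (\<lambda>z. t * base.Dh z X Y S) y V"
      by (rule dir_deriv_cong_open[OF base.open_U y])
        (simp add: bilinear_rmul[OF base.Dh_bilinear])
    also have "\<dots> = t * base.D2h y V X Y S"
      by (rule dir_deriv_eqI)
        (intro has_derivative_mult_right has_derivative_dir_deriv base.Dh_differentiable y)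
    finally show ?thesis .
  qed
  have 3: "total.D2h (y, 0) (0, W) (X, 0) (Z, 0) ?\<zeta> = - ?b\<^sup>2 * base.D2h y W X Z S
      + ?a * ?c * (g y (\<Gamma> X (\<Gamma> W Z)) S + g y (\<Gamma> W Z) (\<Gamma> X S) + g y (D X W Z) S)" for X Z
    unfolding D2h_vertical_horizontal[OF y] D2_scale \<Gamma>_def D_def base.D2h_commute[OF y, where V = X and W = W]
    by (simp add: lin power2_eq_square algebra_simps)
  have "?\<zeta> = ((- b 0) *\<^sub>R S, 0) + (0, a 0 *\<^sub>R S)" by simp
  then have "total.D2h (y, 0) (0, W) ?\<zeta> (Y, 0) (Z, 0) =
      total.D2h (y, 0) (0, W) ((- b 0) *\<^sub>R S, 0) (Y, 0) (Z, 0)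
      + total.D2h (y, 0) (0, W) (0, a 0 *\<^sub>R S) (Y, 0) (Z, 0)"
    by (simp only: linear_add[OF D2h_vertical_linear(2)[OF y]])
  moreover have "total.D2h (y, 0) (0, W) ((- b 0) *\<^sub>R S, 0) (Y, 0) (Z, 0) = - ?b\<^sup>2 * base.D2h y W S Y Z"
  proof -
    have "linear (\<lambda>V. base.D2h y V W Y Z)"
      by (rule linear_frechet_derivative[OF base.Dh_differentiable[OF y]])
    from linear_scale[OF this, of "- b 0" S] show ?thesis
      unfolding D2h_vertical_horizontal[OF y] base.D2h_commute[OF y, where V = W and W = S]
      by (simp add: lin power2_eq_square)
  qed
  moreover have "total.D2h (y, 0) (0, W) (0, a 0 *\<^sub>R S) (Y, 0) (Z, 0) =
      ?a * (2 * deriv a 0 * g y W S * g y Y Z + p 0 * (g y Y W * g y Z S + g y Y S * g y Z W))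
      + ?a * ?c * (g y (\<Gamma> W Y) (\<Gamma> Z S) + g y (\<Gamma> Y S) (\<Gamma> W Z))"
    unfolding D2h_vertical_vertical[OF y] \<Gamma>_def base.christoffel_sym[OF y, of "a 0 *\<^sub>R S"]
    by (simp add: lin algebra_simps)
  ultimately have 4: "total.D2h (y, 0) (0, W) ?\<zeta> (Y, 0) (Z, 0) = - ?b\<^sup>2 * base.D2h y W S Y Z
      + ?a * (2 * deriv a 0 * g y W S * g y Y Z + p 0 * (g y Y W * g y Z S + g y Y S * g y Z W))
      + ?a * ?c * (g y (\<Gamma> W Y) (\<Gamma> Z S) + g y (\<Gamma> Y S) (\<Gamma> W Z))" by simp
  (* The second derivatives of \<open>g\<close> occur in the combination that the differentiated Koszul formula of \<open>g\<close>
     turns into a derivative of the Christoffel map. *)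
  have B: "2 * g y (D W Y Z) S + 2 * base.Dh y W (\<Gamma> Y Z) S =
      base.D2h y W Y Z S + base.D2h y W Z Y S - base.D2h y W S Y Z"
    unfolding \<Gamma>_def D_def by (rule base.koszul_deriv[OF y])
  have s: "g y (\<Gamma> W Z) (\<Gamma> Y S) = g y (\<Gamma> Y S) (\<Gamma> W Z)" by (rule base.sym[OF y])
  show ?thesis
    using K unfolding 1 2 3 4 s
    using arg_cong[OF B, of "\<lambda>t. ?b\<^sup>2 * t"] by (simp add: algebra_simps)
qed

text \<open>The terms with factor \<open>(b 0)\<^sup>2\<close> in the preceding formula and in \<open>curvature_vertical\<close> combine to
\<open>R(W,Y)Z\<close>, those with factor \<open>a 0 * c 0\<close> to one half of \<open>R(Z,Y)W\<close>.\<close>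

lemma curvature_vertical_eq:
  fixes Y Z W S :: 'e
  assumes y: "y \<in> U"
  shows "\<alpha> *\<^sub>R snd (curvature G (y, 0) (0, W) (Y, 0) (Z, 0)) =
    (- (b 0)\<^sup>2) *\<^sub>R curvature g y W Y Z + (a 0 * c 0 / 2) *\<^sub>R curvature g y Z Y W
    - (a 0 * deriv a 0 * g y Y Z) *\<^sub>R W
    - (a 0 * p 0 / 2) *\<^sub>R (g y Y W *\<^sub>R Z + g y Z W *\<^sub>R Y)"
proof (rule base.h_eqI[OF y])
  fix S
  let ?D = "\<lambda>V X Y. dir_deriv (\<lambda>z. christoffel g z X Y) y V"
  have s: "christoffel g y Z W = christoffel g y W Z" "christoffel g y Y W = christoffel g y W Y"
    "christoffel g y Z Y = christoffel g y Y Z"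
    by (rule base.christoffel_sym[OF y])+
  have d: "?D V X Y = ?D V Y X" for V X Y
    by (rule dir_deriv_cong_open[OF base.open_U y]) (rule base.christoffel_sym)
  show "g y (\<alpha> *\<^sub>R snd (curvature G (y, 0) (0, W) (Y, 0) (Z, 0))) S = g y (
    (- (b 0)\<^sup>2) *\<^sub>R curvature g y W Y Z + (a 0 * c 0 / 2) *\<^sub>R curvature g y Z Y W
    - (a 0 * deriv a 0 * g y Y Z) *\<^sub>R W
    - (a 0 * p 0 / 2) *\<^sub>R (g y Y W *\<^sub>R Z + g y Z W *\<^sub>R Y)) S"
    using koszul_fibre_derivative[OF y, of Y Z W S]
    unfolding curvature_vertical[OF y]
    unfolding curvature_def s d[where X = Y and Y = W] d[where X = Z and Y = W]
    by (simp add: base.h_linear[OF y] \<alpha>_def power2_eq_square field_simps)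
qed

end

lemma sum_over_product_basis:
  fixes f :: "'a::euclidean_space \<times> 'b::euclidean_space \<Rightarrow> real"
  shows "(\<Sum>e\<in>Basis. f e) = (\<Sum>e\<in>Basis. f (e, 0)) + (\<Sum>e\<in>Basis. f (0, e))"
proof -
  have "inj_on (\<lambda>u. (u::'a, 0::'b)) Basis" "inj_on (\<lambda>u. (0::'a, u::'b)) Basis"
    by (auto intro!: inj_onI)
  then show ?thesis
    unfolding Basis_prod_def
    by (subst sum.union_disjoint) (auto simp: sum.reindex)
qed

context natural_metric_in_chart
begin

text \<open>The horizontal part of the trace contributes \<open>Ric\<^sub>g\<close> with factor \<open>\<alpha>\<close>, the vertical part contributes it with
factor \<open>- (b 0)\<^sup>2\<close>; this is where the number \<open>a c - 2 b\<^sup>2\<close> comes from. The term \<open>R(Z,Y)W\<close> has trace 0.\<close>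

lemma ricci_zero_section:
  assumes y: "y \<in> U"
  shows "\<alpha> * ricci G (y, 0) (Y, 0) (Z, 0) =
    (a 0 * c 0 - 2 * (b 0)\<^sup>2) * ricci g y Y Z
    - a 0 * (real DIM('e) * deriv a 0 + p 0) * g y Y Z"
proof -
  have tr: "(\<Sum>e\<in>Basis. g y X e * (V \<bullet> e)) = g y X V" for X V
  proof -
    have r: "linear (g y X)" using base.bilin[OF y] by (auto simp: bilinear_def)
    have "g y X V = g y X (\<Sum>e\<in>Basis. (V \<bullet> e) *\<^sub>R e)" by (simp add: euclidean_representation)
    also have "\<dots> = (\<Sum>e\<in>Basis. g y X e * (V \<bullet> e))"
      by (simp add: linear_sum[OF r] linear_scale[OF r] mult.commute)
    finally show ?thesis by simp
  qed
  have "\<alpha> * (\<Sum>e\<in>Basis. snd (curvature G (y, 0) (0, e) (Y, 0) (Z, 0)) \<bullet> e) =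
      (\<Sum>e\<in>Basis. (\<alpha> *\<^sub>R snd (curvature G (y, 0) (0, e) (Y, 0) (Z, 0))) \<bullet> e)"
    by (simp add: sum_distrib_left)
  also have "\<dots> = - (b 0)\<^sup>2 * (\<Sum>e\<in>Basis. curvature g y e Y Z \<bullet> e)
      + (a 0 * c 0 / 2) * (\<Sum>e\<in>Basis. curvature g y Z Y e \<bullet> e)
      - (a 0 * deriv a 0 * g y Y Z) * (\<Sum>e\<in>Basis. (e::'e) \<bullet> e)
      - (a 0 * p 0 / 2) * ((\<Sum>e\<in>Basis. g y Y e * (Z \<bullet> e)) + (\<Sum>e\<in>Basis. g y Z e * (Y \<bullet> e)))"
    unfolding curvature_vertical_eq[OF y]
    by (simp add: inner_add_left inner_diff_left sum.distrib sum_subtractf sum_distrib_left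
        sum_negf distrib_left del: inner_same_Basis)
  also have "\<dots> = - (b 0)\<^sup>2 * ricci g y Y Z - a 0 * (real DIM('e) * deriv a 0 + p 0) * g y Y Z"
    unfolding base.curvature_trace[OF y] tr base.sym[OF y, of Z Y]
    by (simp add: ricci_def algebra_simps)
  finally have v: "\<alpha> * (\<Sum>e\<in>Basis. snd (curvature G (y, 0) (0, e) (Y, 0) (Z, 0)) \<bullet> e) =
    - (b 0)\<^sup>2 * ricci g y Y Z - a 0 * (real DIM('e) * deriv a 0 + p 0) * g y Y Z" .
  have "ricci G (y, 0) (Y, 0) (Z, 0) = ricci g y Y Z
      + (\<Sum>e\<in>Basis. snd (curvature G (y, 0) (0, e) (Y, 0) (Z, 0)) \<bullet> e)"
    unfolding ricci_def sum_over_product_basis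
    by (simp add: inner_prod_def curvature_horizontal[OF y])
  then show ?thesis
    using v by (simp add: \<alpha>_def algebra_simps)
qed

text \<open>At a zero vector \<open>G((X,W),(Z,0)) = g(a X + b W, Z)\<close>, and the derivative of \<open>G((Y,0),(Z,0))\<close> in the
direction \<open>(X,W)\<close> is that of \<open>g(Y, Z)\<close> in the direction \<open>a X + b W\<close>. So all three terms of the Lie
derivative only see the combination \<open>a X + b W\<close> of the components of \<open>V\<close>.\<close>

lemma lie_derivative_zero_section:
  assumes y: "y \<in> U" and V: "V differentiable (at (y, 0))"
  shows "lie_derivative V G (y, 0) (Y, 0) (Z, 0) =
    lie_derivative (\<lambda>y. a 0 *\<^sub>R fst (V (y, 0)) + b 0 *\<^sub>R snd (V (y, 0))) g y Y Z"
proof -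
  define V1 V2 where "V1 y = fst (V (y, 0))" and "V2 y = snd (V (y, 0))" for y
  note d = has_derivative_zero_slice[OF V]
  have D: "dir_deriv V (y, 0) (T, 0) = (dir_deriv V1 y T, dir_deriv V2 y T)" for T
    using dir_deriv_eqI[OF has_derivative_fst[OF d], of T] dir_deriv_eqI[OF has_derivative_snd[OF d], of T]
    by (simp add: V1_def[abs_def] V2_def[abs_def] prod_eq_iff)
  have V12: "V1 differentiable (at y)" "V2 differentiable (at y)"
    unfolding V1_def[abs_def] V2_def[abs_def]
    by (rule differentiableI, rule has_derivative_fst[OF d] has_derivative_snd[OF d])+
  have DV: "dir_deriv (\<lambda>y. a 0 *\<^sub>R V1 y + b 0 *\<^sub>R V2 y) y T = a 0 *\<^sub>R dir_deriv V1 y T + b 0 *\<^sub>R dir_deriv V2 y T" for T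
    by (rule dir_deriv_eqI)
      (intro has_derivative_add has_derivative_scaleR_right has_derivative_dir_deriv V12)
  have V0: "V (y, 0) = (V1 y, V2 y)" by (simp add: V1_def V2_def)
  have "total.Dh (y, 0) (V1 y, V2 y) (Y, 0) (Z, 0) = a 0 * base.Dh y (V1 y) Y Z + b 0 * base.Dh y (V2 y) Y Z"
    by (subst Dh_split[OF y], unfold Dh_horizontal[OF y] Dh_vertical[OF y] base.metric_compatible[OF y])
      (simp add: base.h_linear[OF y] base.christoffel_linear[OF y] distrib_left)
  moreover have "base.Dh y (a 0 *\<^sub>R V1 y + b 0 *\<^sub>R V2 y) Y Z = a 0 * base.Dh y (V1 y) Y Z + b 0 * base.Dh y (V2 y) Y Z"
    by (simp add: linear_add[OF base.Dh_linear[OF y]] linear_scale[OF base.Dh_linear[OF y]])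
  ultimately show ?thesis
    unfolding lie_derivative_def V0 D V1_def[symmetric] V2_def[symmetric] DV G_zero[OF y]
    by (simp add: base.h_linear[OF y] algebra_simps)
qed

text \<open>The two preceding formulas, inserted into the soliton equation of \<open>G\<close> multiplied by \<open>\<alpha> / D\<close>.\<close>

lemma soliton_zero_section:
  assumes y: "y \<in> U" and V: "V differentiable (at (y, 0))"
    and D: "D = a 0 * c 0 - 2 * (b 0)\<^sup>2" "D \<noteq> 0"
    and soliton: "ricci G (y, 0) (Y, 0) (Z, 0) + 1 / 2 * lie_derivative V G (y, 0) (Y, 0) (Z, 0)
      = k * G (y, 0) (Y, 0) (Z, 0)"
  shows "ricci g y Y Z + 1 / 2 * lie_derivative
      (\<lambda>y. (\<alpha> / D) *\<^sub>R (a 0 *\<^sub>R fst (V (y, 0)) + b 0 *\<^sub>R snd (V (y, 0)))) g y Y Z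
    = (a 0 * (k * \<alpha> + p 0 + real DIM('e) * deriv a 0) / D) * g y Y Z"
proof -
  let ?V = "\<lambda>y. a 0 *\<^sub>R fst (V (y, 0)) + b 0 *\<^sub>R snd (V (y, 0))"
  note d = has_derivative_zero_slice[OF V]
  have "(?V has_derivative (\<lambda>T. a 0 *\<^sub>R fst (dir_deriv V (y, 0) (T, 0)) + b 0 *\<^sub>R snd (dir_deriv V (y, 0) (T, 0)))) (at y)"
    by (intro has_derivative_add has_derivative_scaleR_right has_derivative_fst[OF d] has_derivative_snd[OF d])
  then have "?V differentiable (at y)" by (rule differentiableI)
  then have "dir_deriv (\<lambda>y. t *\<^sub>R ?V y) y X = t *\<^sub>R dir_deriv ?V y X" for t X
    by (intro dir_deriv_eqI has_derivative_scaleR_right has_derivative_dir_deriv)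
  then have L: "lie_derivative (\<lambda>y. t *\<^sub>R ?V y) g y Y Z = t * lie_derivative ?V g y Y Z" for t
    unfolding lie_derivative_def
    by (simp add: linear_scale[OF base.Dh_linear[OF y]] base.h_linear[OF y] distrib_left)
  have "\<alpha> * (ricci G (y, 0) (Y, 0) (Z, 0) + 1 / 2 * lie_derivative ?V g y Y Z) = \<alpha> * (k * (a 0 * g y Y Z))"
    using soliton unfolding lie_derivative_zero_section[OF y V]
    by (simp add: G_zero[OF y] base.h_linear[OF y])
  then have "D * ricci g y Y Z + \<alpha> / 2 * lie_derivative ?V g y Y Z
      = a 0 * (k * \<alpha> + p 0 + real DIM('e) * deriv a 0) * g y Y Z"
    using ricci_zero_section[OF y, of Y Z] unfolding D(1)[symmetric] by (simp add: algebra_simps)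
  then have "(D * ricci g y Y Z + \<alpha> / 2 * lie_derivative ?V g y Y Z) / D
      = a 0 * (k * \<alpha> + p 0 + real DIM('e) * deriv a 0) * g y Y Z / D"
    by (rule arg_cong)
  then show ?thesis
    unfolding L using D(2) by (simp add: add_divide_distrib)
qed

end

section \<open>Tangent vectors and coordinate changes\<close>

text \<open>What the linear algebra of tangent vectors uses of an atlas, stated separately so that it can be
applied both to the base and to the induced atlas of the tangent bundle.\<close>

locale differentiable_atlas =
  fixes A :: "('m, 'e::euclidean_space) chart set"
  assumes chart_inj: "c \<in> A \<Longrightarrow> inj_on (coord c) (dom_of c)"
    and chart_open: "c \<in> A \<Longrightarrow> open (img_of c)"
    and overlap_open: "c \<in> A \<Longrightarrow> c' \<in> A \<Longrightarrow> open (coord c ` (dom_of c \<inter> dom_of c'))"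
    and trans_differentiable: "c \<in> A \<Longrightarrow> c' \<in> A \<Longrightarrow> x \<in> dom_of c \<Longrightarrow> x \<in> dom_of c' \<Longrightarrow>
      trans_map c c' differentiable (at (coord c x))"
begin

lemma point_at_coord: "c \<in> A \<Longrightarrow> x \<in> dom_of c \<Longrightarrow> point_at c (coord c x) = x"
  by (simp add: point_at_def chart_inj)

lemma point_at_img:
  assumes "y \<in> img_of c" shows "point_at c y \<in> dom_of c" "coord c (point_at c y) = y"
  using assms unfolding point_at_def img_of_def by (auto intro: inv_into_into f_inv_into_f)

lemma trans_map_coord: "c \<in> A \<Longrightarrow> x \<in> dom_of c \<Longrightarrow> trans_map c c' (coord c x) = coord c' x"
  by (simp add: trans_map_def point_at_coord)

lemma trans_deriv_linear:
  "c \<in> charts_at A x \<Longrightarrow> c' \<in> charts_at A x \<Longrightarrow> linear (dir_deriv (trans_map c c') (coord c x))"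
  by (rule linear_frechet_derivative[OF trans_differentiable]) (auto simp: charts_at_def)

lemma trans_deriv_refl:
  assumes "c \<in> charts_at A x" shows "dir_deriv (trans_map c c) (coord c x) w = w"
proof -
  have c: "c \<in> A" "x \<in> dom_of c" using assms by (auto simp: charts_at_def)
  have "dir_deriv (trans_map c c) (coord c x) w = dir_deriv (\<lambda>y. y) (coord c x) w"
  proof (rule dir_deriv_cong_open[OF chart_open[OF c(1)]])
    show "coord c x \<in> img_of c" using c(2) by (simp add: img_of_def)
    show "trans_map c c y = y" if "y \<in> img_of c" for y
      using point_at_img[OF that] trans_map_coord[OF c(1), of "point_at c y" c] by simp
  qed
  then show ?thesis by (simp only: frechet_derivative_ident)
qed

text \<open>The chain rule for changes of charts. It makes a tangent vector determined by, and freely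
prescribable in, any single chart.\<close>

lemma trans_deriv_cocycle:
  assumes "c \<in> charts_at A x" "c' \<in> charts_at A x" "c'' \<in> charts_at A x"
  shows "dir_deriv (trans_map c' c'') (coord c' x) (dir_deriv (trans_map c c') (coord c x) w) =
    dir_deriv (trans_map c c'') (coord c x) w"
proof -
  have c: "c \<in> A" "x \<in> dom_of c" "c' \<in> A" "x \<in> dom_of c'" "c'' \<in> A" "x \<in> dom_of c''"
    using assms by (auto simp: charts_at_def)
  have 1: "(trans_map c c' has_derivative dir_deriv (trans_map c c') (coord c x)) (at (coord c x))"
    by (rule has_derivative_dir_deriv[OF trans_differentiable]) (use c in auto)
  have 2: "(trans_map c' c'' has_derivative dir_deriv (trans_map c' c'') (coord c' x)) (at (trans_map c c' (coord c x)))"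
    unfolding trans_map_coord[OF c(1,2)]
    by (rule has_derivative_dir_deriv[OF trans_differentiable]) (use c in auto)
  have "dir_deriv (trans_map c c'') (coord c x) w = dir_deriv (\<lambda>y. trans_map c' c'' (trans_map c c' y)) (coord c x) w"
  proof (rule dir_deriv_cong_open)
    show "open (coord c ` (dom_of c \<inter> dom_of c'))" by (rule overlap_open[OF c(1,3)])
    show "coord c x \<in> coord c ` (dom_of c \<inter> dom_of c')" using c by blast
    fix y assume "y \<in> coord c ` (dom_of c \<inter> dom_of c')"
    then obtain x' where x': "y = coord c x'" "x' \<in> dom_of c" "x' \<in> dom_of c'" by blast
    show "trans_map c c'' y = trans_map c' c'' (trans_map c c' y)"
      unfolding x'(1) trans_map_coord[OF c(1) x'(2)] trans_map_coord[OF c(3) x'(3)] ..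
  qed
  also have "\<dots> = dir_deriv (trans_map c' c'') (coord c' x) (dir_deriv (trans_map c c') (coord c x) w)"
    by (rule dir_deriv_eqI[OF has_derivative_compose[OF 1 2]])
  finally show ?thesis ..
qed

lemma trans_deriv_surj:
  assumes "c \<in> charts_at A x" "c' \<in> charts_at A x"
  shows "surj (dir_deriv (trans_map c c') (coord c x))"
proof (rule surjI)
  show "dir_deriv (trans_map c c') (coord c x) (dir_deriv (trans_map c' c) (coord c' x) w) = w" for w
    by (simp only: trans_deriv_cocycle[OF assms(2,1,2)] trans_deriv_refl[OF assms(2)])
qed

lemma tvec_of_in_tangent_space:
  "c \<in> charts_at A x \<Longrightarrow> tvec_of A c x w \<in> tangent_space A x"
  by (simp add: tangent_space_def tvec_of_def trans_deriv_cocycle)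

lemma tvec_of_component: "c \<in> charts_at A x \<Longrightarrow> tvec_of A c x w c = w"
  by (simp add: tvec_of_def trans_deriv_refl)

lemma tvec_of_components:
  assumes "c \<in> charts_at A x" "u \<in> tangent_space A x" shows "tvec_of A c x (u c) = u"
proof
  fix d
  have 0: "u d = 0" if "d \<notin> charts_at A x"
    using assms(2) that unfolding tangent_space_def by blast
  have "u d = dir_deriv (trans_map c d) (coord c x) (u c)" if "d \<in> charts_at A x"
    using assms that unfolding tangent_space_def by blast
  then show "tvec_of A c x (u c) d = u d" using 0 by (simp add: tvec_of_def)
qed

lemma tvec_of_change_chart:
  assumes "c \<in> charts_at A x" "c' \<in> charts_at A x"
  shows "tvec_of A c' x (dir_deriv (trans_map c c') (coord c x) w) = tvec_of A c x w"
  unfolding tvec_of_def by (rule ext) (use trans_deriv_cocycle[OF assms] in simp)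

lemma tvec_of_linear:
  assumes "c \<in> charts_at A x"
  shows "tvec_of A c x (r *\<^sub>R w + w') = (\<lambda>d. r *\<^sub>R tvec_of A c x w d + tvec_of A c x w' d)"
  unfolding tvec_of_def
  by (rule ext) (simp add: linear_add[OF trans_deriv_linear[OF assms]] linear_scale[OF trans_deriv_linear[OF assms]])

lemma tvec_of_0: "c \<in> charts_at A x \<Longrightarrow> tvec_of A c x 0 = (\<lambda>d. 0)"
  unfolding tvec_of_def by (rule ext) (simp add: linear_0[OF trans_deriv_linear])

lemma tangent_vector_eqI:
  assumes "c \<in> charts_at A x" "u \<in> tangent_space A x" "v \<in> tangent_space A x" "u c = v c"
  shows "u = v"
proof -
  have "u = tvec_of A c x (u c)" by (rule tvec_of_components[OF assms(1,2), symmetric])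
  also have "\<dots> = tvec_of A c x (v c)" by (simp only: assms(4))
  also have "\<dots> = v" by (rule tvec_of_components[OF assms(1,3)])
  finally show ?thesis .
qed

lemma form_rep_change_chart:
  assumes "c \<in> A" "c' \<in> A" "z \<in> coord c ` (dom_of c \<inter> dom_of c')"
  shows "form_rep A c h z X Y = form_rep A c' h (trans_map c c' z)
    (dir_deriv (trans_map c c') z X) (dir_deriv (trans_map c c') z Y)"
proof -
  obtain x where x: "z = coord c x" "x \<in> dom_of c" "x \<in> dom_of c'" using assms(3) by blast
  have c: "c \<in> charts_at A x" "c' \<in> charts_at A x" using x assms by (auto simp: charts_at_def)
  show ?thesis
    unfolding form_rep_def x(1) trans_map_coord[OF assms(1) x(2)] point_at_coord[OF assms(1) x(2)]
      point_at_coord[OF assms(2) x(3)] tvec_of_change_chart[OF c] ..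
qed

text \<open>Nondegeneracy passes to the coordinate expression because every tangent vector at a point is
determined by its components in the chart, which are arbitrary.\<close>

lemma form_rep_local_metric:
  assumes h: "pseudo_riemannian_metric A h" and c: "c \<in> A"
  shows "local_metric (img_of c) (form_rep A c h)"
proof
  have h': "symmetric_form_field A h" using h by (simp add: pseudo_riemannian_metric_def)
  show "open (img_of c)" by (rule chart_open[OF c])
  show "smooth_on (img_of c) (\<lambda>y. form_rep A c h y X Y)" for X Y
    using h' c by (simp add: symmetric_form_field_def)
  fix y assume y: "y \<in> img_of c"
  define x where "x = point_at c y"
  have x: "x \<in> points A" "c \<in> charts_at A x"
    using point_at_img[OF y] c by (auto simp: x_def points_def charts_at_def)
  note T = tvec_of_in_tangent_space[OF x(2)]
  show s: "form_rep A c h y X Y = form_rep A c h y Y X" for X Y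
    using h' x(1) T by (simp add: form_rep_def symmetric_form_field_def x_def[symmetric])
  have l: "form_rep A c h y (r *\<^sub>R X + X') Y = r * form_rep A c h y X Y + form_rep A c h y X' Y" for r X X' Y
    using h' x(1) T by (simp add: form_rep_def symmetric_form_field_def x_def[symmetric] tvec_of_linear[OF x(2)])
  have lin: "linear (\<lambda>X. form_rep A c h y X Y)" for Y
  proof (rule linearI)
    show "form_rep A c h y (X + X') Y = form_rep A c h y X Y + form_rep A c h y X' Y" for X X'
      using l[of 1 X X' Y] by simp
    have "form_rep A c h y 0 Y = 0" using l[of 1 0 0 Y] by simp
    then show "form_rep A c h y (r *\<^sub>R X) Y = r *\<^sub>R form_rep A c h y X Y" for r X
      using l[of r X 0 Y] by simp
  qed
  show "bilinear (form_rep A c h y)"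
    unfolding bilinear_def using lin s by simp
  show "X = 0" if "\<And>Z. form_rep A c h y X Z = 0" for X
  proof -
    have "h x (tvec_of A c x X) v = 0" if "v \<in> tangent_space A x" for v
      using \<open>\<And>Z. form_rep A c h y X Z = 0\<close>[of "v c"] tvec_of_components[OF x(2) that]
      by (simp add: form_rep_def x_def[symmetric])
    then have "tvec_of A c x X = (\<lambda>c. 0)"
      using h x(1) T by (simp add: pseudo_riemannian_metric_def)
    then show ?thesis using tvec_of_component[OF x(2), of X] by simp
  qed
qed

end

lemma smooth_atlas_differentiable: "smooth_atlas A \<Longrightarrow> differentiable_atlas A"
  by unfold_locales (auto simp: smooth_atlas_def intro: smooth_on_differentiable)

lemma riemannian_imp_pseudo_riemannian:
  assumes "riemannian_metric A g" shows "pseudo_riemannian_metric A g"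
  using assms unfolding riemannian_metric_def pseudo_riemannian_metric_def by (metis less_irrefl)

section \<open>The tangent bundle\<close>

text \<open>The changes of induced charts contain the first derivatives of the changes of charts, so
smoothness of the atlas is used to make the induced atlas differentiable.\<close>

locale base_atlas = differentiable_atlas A for A :: "('m, 'e::euclidean_space) chart set" +
  assumes smooth_atlas: "smooth_atlas A"
begin

lemma trans_smooth:
  assumes "c \<in> A" "c' \<in> A"
  shows "smooth_on (coord c ` (dom_of c \<inter> dom_of c')) (trans_map c c')"
  using smooth_atlas assms unfolding smooth_atlas_def by blast

lemma zero_tangent: "(\<lambda>c. 0) \<in> tangent_space A x"
  using linear_0[OF trans_deriv_linear] by (simp add: tangent_space_def)

lemma dom_tangent_chart: "(x, u) \<in> dom_of (tangent_chart A c) \<longleftrightarrow> x \<in> dom_of c \<and> u \<in> tangent_space A x"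
  by (simp add: dom_of_def tangent_chart_def)

lemma coord_tangent_chart: "coord (tangent_chart A c) (x, u) = (coord c x, u c)"
  by (simp add: coord_def tangent_chart_def)

lemma tangent_chart_overlap:
  assumes "c \<in> A" "c' \<in> A"
  shows "coord (tangent_chart A c) ` (dom_of (tangent_chart A c) \<inter> dom_of (tangent_chart A c')) =
    coord c ` (dom_of c \<inter> dom_of c') \<times> UNIV"
proof (intro set_eqI iffI)
  fix p assume "p \<in> coord (tangent_chart A c) ` (dom_of (tangent_chart A c) \<inter> dom_of (tangent_chart A c'))"
  then show "p \<in> coord c ` (dom_of c \<inter> dom_of c') \<times> UNIV"
    by (auto simp: dom_tangent_chart coord_tangent_chart)
next
  fix p assume "p \<in> coord c ` (dom_of c \<inter> dom_of c') \<times> (UNIV :: 'e set)"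
  then obtain x w where x: "p = (coord c x, w)" "x \<in> dom_of c" "x \<in> dom_of c'" by auto
  have c: "c \<in> charts_at A x" using x assms by (simp add: charts_at_def)
  show "p \<in> coord (tangent_chart A c) ` (dom_of (tangent_chart A c) \<inter> dom_of (tangent_chart A c'))"
    by (rule image_eqI[where x = "(x, tvec_of A c x w)"])
      (simp_all add: x coord_tangent_chart dom_tangent_chart tvec_of_component[OF c] tvec_of_in_tangent_space[OF c])
qed

lemma img_tangent_chart:
  assumes "c \<in> A" shows "img_of (tangent_chart A c) = img_of c \<times> UNIV"
  using tangent_chart_overlap[OF assms assms] unfolding Int_absorb img_of_def .

lemma inj_tangent_chart:
  assumes "c \<in> A" shows "inj_on (coord (tangent_chart A c)) (dom_of (tangent_chart A c))"
proof (rule inj_onI)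
  fix p q assume pq: "p \<in> dom_of (tangent_chart A c)" "q \<in> dom_of (tangent_chart A c)"
    "coord (tangent_chart A c) p = coord (tangent_chart A c) q"
  obtain x u where p: "p = (x, u)" by (cases p)
  obtain x' u' where q: "q = (x', u')" by (cases q)
  have x: "x \<in> dom_of c" "u \<in> tangent_space A x" and x': "x' \<in> dom_of c" "u' \<in> tangent_space A x'"
    and e: "coord c x = coord c x'" "u c = u' c"
    using pq unfolding p q dom_tangent_chart coord_tangent_chart by simp_all
  have xx: "x = x'" by (rule inj_onD[OF chart_inj[OF assms] e(1) x(1) x'(1)])
  have c: "c \<in> charts_at A x" using x(1) assms by (simp add: charts_at_def)
  have "u = u'" by (rule tangent_vector_eqI[OF c x(2) x'(2)[folded xx] e(2)])
  then show "p = q" by (simp only: p q xx)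
qed

lemma point_at_tangent_chart:
  assumes "c \<in> A" "y \<in> img_of c"
  shows "point_at (tangent_chart A c) (y, w) = (point_at c y, tvec_of A c (point_at c y) w)"
proof -
  let ?x = "point_at c y"
  have x: "?x \<in> dom_of c" "coord c ?x = y" by (rule point_at_img[OF assms(2)])+
  then have c: "c \<in> charts_at A ?x" using assms by (simp add: charts_at_def)
  have "coord (tangent_chart A c) (?x, tvec_of A c ?x w) = (y, w)"
    by (simp add: coord_tangent_chart x tvec_of_component[OF c])
  moreover have "(?x, tvec_of A c ?x w) \<in> dom_of (tangent_chart A c)"
    by (simp add: dom_tangent_chart x tvec_of_in_tangent_space[OF c])
  note inv_into_f_f[OF inj_tangent_chart[OF assms(1)] this]
  ultimately show ?thesis by (simp only: point_at_def[of "tangent_chart A c"])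
qed

lemma trans_map_tangent_chart:
  assumes "c \<in> A" "c' \<in> A" "y \<in> coord c ` (dom_of c \<inter> dom_of c')"
  shows "trans_map (tangent_chart A c) (tangent_chart A c') (y, w) =
    (trans_map c c' y, dir_deriv (trans_map c c') y w)"
proof -
  have y: "y \<in> img_of c" using assms(3) by (auto simp: img_of_def)
  let ?x = "point_at c y"
  have x: "?x \<in> dom_of c'" "coord c ?x = y" using assms point_at_coord[OF assms(1)] by auto
  then have "c' \<in> charts_at A ?x" using assms(2) by (simp add: charts_at_def)
  then show ?thesis
    using x by (simp add: trans_map_def[of "tangent_chart A c"] point_at_tangent_chart[OF assms(1) y]
      coord_tangent_chart trans_map_def[of c c', THEN fun_cong] tvec_of_def)
qed

lemma trans_map_tangent_chart_deriv:
  assumes c: "c \<in> charts_at A x" "c' \<in> charts_at A x"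
  shows "(trans_map (tangent_chart A c) (tangent_chart A c') has_derivative
    (\<lambda>(X, W). (dir_deriv (trans_map c c') (coord c x) X,
      dir_deriv (\<lambda>y. dir_deriv (trans_map c c') y w) (coord c x) X + dir_deriv (trans_map c c') (coord c x) W)))
    (at (coord c x, w))"
proof -
  let ?S = "coord c ` (dom_of c \<inter> dom_of c')"
  have cA: "c \<in> A" "c' \<in> A" and x: "coord c x \<in> ?S" using c by (auto simp: charts_at_def)
  have S: "open ?S" by (rule overlap_open[OF cA])
  show ?thesis
  proof (rule has_derivative_transform_within_open[OF has_derivative_tangent_map[OF S x trans_smooth[OF cA]]])
    show "open (?S \<times> (UNIV :: 'e set))" using S by (simp add: open_Times)
    show "(coord c x, w) \<in> ?S \<times> UNIV" using x by simp
    fix p :: "'e \<times> 'e" assume "p \<in> ?S \<times> UNIV"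
    then obtain y w where "p = (y, w)" "y \<in> ?S" by blast
    then show "(case p of (y, w) \<Rightarrow> (trans_map c c' y, dir_deriv (trans_map c c') y w)) =
        trans_map (tangent_chart A c) (tangent_chart A c') p"
      by (simp only: trans_map_tangent_chart[OF cA] prod.case)
  qed
qed

lemma charts_at_tangent:
  assumes "u \<in> tangent_space A x"
  shows "charts_at (tangent_atlas A) (x, u) = tangent_chart A ` charts_at A x"
  using assms by (auto simp: charts_at_def tangent_atlas_def dom_tangent_chart)

sublocale tangent: differentiable_atlas "tangent_atlas A"
proof
  fix C assume "C \<in> tangent_atlas A"
  then obtain c where c: "c \<in> A" "C = tangent_chart A c" by (auto simp: tangent_atlas_def)
  show "inj_on (coord C) (dom_of C)" using inj_tangent_chart c by simp
  show "open (img_of C)" using chart_open c by (simp add: img_tangent_chart open_Times)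
  fix C' assume "C' \<in> tangent_atlas A"
  then obtain c' where c': "c' \<in> A" "C' = tangent_chart A c'" by (auto simp: tangent_atlas_def)
  show "open (coord C ` (dom_of C \<inter> dom_of C'))"
    using overlap_open c c' by (simp add: tangent_chart_overlap open_Times)
  fix p assume p: "p \<in> dom_of C" "p \<in> dom_of C'"
  obtain x u where xu: "p = (x, u)" by (cases p)
  have "c \<in> charts_at A x" "c' \<in> charts_at A x"
    using p c c' by (auto simp: xu dom_tangent_chart charts_at_def)
  from trans_map_tangent_chart_deriv[OF this]
  show "trans_map C C' differentiable (at (coord C p))"
    unfolding c(2) c'(2) xu coord_tangent_chart by (rule differentiableI)
qed

text \<open>At zero vectors the second derivative of the change of charts drops out, so both components of a tangent
vector of the bundle transform as tangent vectors of the base. Hence the horizontal and vertical parts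
of a vector field on the bundle restrict to vector fields on the base.\<close>

lemma tangent_vector_at_zero_change:
  assumes \<xi>: "\<xi> \<in> tangent_space (tangent_atlas A) (zero_vector x)"
    and c: "c \<in> charts_at A x" "c' \<in> charts_at A x"
  shows "\<xi> (tangent_chart A c') = (dir_deriv (trans_map c c') (coord c x) (fst (\<xi> (tangent_chart A c))),
    dir_deriv (trans_map c c') (coord c x) (snd (\<xi> (tangent_chart A c))))"
proof -
  let ?T = "trans_map (tangent_chart A c) (tangent_chart A c')"
  have cA: "c \<in> A" "c' \<in> A" "coord c x \<in> coord c ` (dom_of c \<inter> dom_of c')" using c by (auto simp: charts_at_def)
  have C: "tangent_chart A d \<in> charts_at (tangent_atlas A) (zero_vector x)" if "d \<in> charts_at A x" for d
    using that by (simp add: zero_vector_def charts_at_tangent[OF zero_tangent])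
  have "\<xi> (tangent_chart A c') = dir_deriv ?T (coord (tangent_chart A c) (zero_vector x)) (\<xi> (tangent_chart A c))"
    using \<xi> C[OF c(1)] C[OF c(2)] unfolding tangent_space_def by blast
  also have "coord (tangent_chart A c) (zero_vector x) = (coord c x, 0)"
    by (simp add: zero_vector_def coord_tangent_chart)
  also have "dir_deriv ?T (coord c x, 0) (\<xi> (tangent_chart A c)) =
    (dir_deriv (trans_map c c') (coord c x) (fst (\<xi> (tangent_chart A c))),
     dir_deriv (\<lambda>y. dir_deriv (trans_map c c') y 0) (coord c x) (fst (\<xi> (tangent_chart A c)))
     + dir_deriv (trans_map c c') (coord c x) (snd (\<xi> (tangent_chart A c))))"
    unfolding dir_deriv_eqI[OF trans_map_tangent_chart_deriv[OF c]] by (simp add: case_prod_unfold)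
  also have "dir_deriv (\<lambda>y. dir_deriv (trans_map c c') y 0) (coord c x) v = 0" for v
  proof -
    have "dir_deriv (\<lambda>y. dir_deriv (trans_map c c') y 0) (coord c x) v = dir_deriv (\<lambda>y. 0) (coord c x) v"
    proof (rule dir_deriv_cong_open[OF overlap_open[OF cA(1,2)] cA(3)])
      fix y assume "y \<in> coord c ` (dom_of c \<inter> dom_of c')"
      then show "dir_deriv (trans_map c c') y 0 = 0"
        by (intro linear_0 linear_frechet_derivative smooth_on_differentiable[OF trans_smooth[OF cA(1,2)]])
    qed
    then show ?thesis by simp
  qed
  finally show ?thesis by simp
qed

lemma christoffel_change_chart:
  assumes g: "pseudo_riemannian_metric A g"
    and c: "c \<in> charts_at A x" "c' \<in> charts_at A x"
  shows "dir_deriv (trans_map c c') (coord c x) (christoffel (form_rep A c g) (coord c x) X Y) =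
    christoffel (form_rep A c' g) (coord c' x) (dir_deriv (trans_map c c') (coord c x) X)
      (dir_deriv (trans_map c c') (coord c x) Y)
    + dir_deriv (\<lambda>z. dir_deriv (trans_map c c') z X) (coord c x) Y"
proof -
  let ?S = "coord c ` (dom_of c \<inter> dom_of c')"
  have cA: "c \<in> A" "c' \<in> A" and x: "coord c x \<in> ?S" and xd: "x \<in> dom_of c" using c by (auto simp: charts_at_def)
  have im: "trans_map c c' z \<in> img_of c'" if "z \<in> ?S" for z
  proof -
    obtain x where x: "z = coord c x" "x \<in> dom_of c" "x \<in> dom_of c'" using \<open>z \<in> ?S\<close> by blast
    show ?thesis unfolding x(1) trans_map_coord[OF cA(1) x(2)] img_of_def using x(3) by blast
  qed
  have sub: "?S \<subseteq> img_of c" by (auto simp: img_of_def)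
  from christoffel_transform[OF form_rep_local_metric[OF g cA(1)] form_rep_local_metric[OF g cA(2)]
      overlap_open[OF cA] sub trans_smooth[OF cA] im form_rep_change_chart[OF cA] x trans_deriv_surj[OF c]]
  show ?thesis unfolding trans_map_coord[OF cA(1) xd] .
qed

text \<open>Lifts are specified by their components in all induced charts. Such a specification has a unique
solution if it is consistent under changes of charts, and the solution can then be read off in one chart.\<close>

lemma tangent_lift_eq:
  assumes u: "u \<in> tangent_space A x" and c: "c \<in> charts_at A x"
    and F: "\<And>c c'. c \<in> charts_at A x \<Longrightarrow> c' \<in> charts_at A x \<Longrightarrow>
      F c' = (dir_deriv (trans_map c c') (coord c x) (fst (F c)),
        dir_deriv (\<lambda>y. dir_deriv (trans_map c c') y (u c)) (coord c x) (fst (F c))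
        + dir_deriv (trans_map c c') (coord c x) (snd (F c)))"
  shows "(THE \<xi>. \<xi> \<in> tangent_space (tangent_atlas A) (x, u) \<and> (\<forall>c\<in>charts_at A x. \<xi> (tangent_chart A c) = F c))
    = tvec_of (tangent_atlas A) (tangent_chart A c) (x, u) (F c)"
proof (rule the_equality)
  let ?\<xi> = "tvec_of (tangent_atlas A) (tangent_chart A c) (x, u) (F c)"
  have C: "tangent_chart A d \<in> charts_at (tangent_atlas A) (x, u)" if "d \<in> charts_at A x" for d
    using that by (simp add: charts_at_tangent[OF u])
  have "?\<xi> (tangent_chart A d) = F d" if d: "d \<in> charts_at A x" for d
  proof -
    have "?\<xi> (tangent_chart A d) = dir_deriv (trans_map (tangent_chart A c) (tangent_chart A d)) (coord c x, u c) (F c)"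
      using C[OF d] by (simp add: tvec_of_def coord_tangent_chart)
    also have "\<dots> = F d"
      unfolding dir_deriv_eqI[OF trans_map_tangent_chart_deriv[OF c d]]
      using F[OF c d] by (simp add: case_prod_unfold)
    finally show ?thesis .
  qed
  then show "?\<xi> \<in> tangent_space (tangent_atlas A) (x, u) \<and> (\<forall>c\<in>charts_at A x. ?\<xi> (tangent_chart A c) = F c)"
    using tangent.tvec_of_in_tangent_space[OF C[OF c]] by blast
  fix \<xi> assume "\<xi> \<in> tangent_space (tangent_atlas A) (x, u) \<and> (\<forall>c\<in>charts_at A x. \<xi> (tangent_chart A c) = F c)"
  then show "\<xi> = ?\<xi>"
    using tangent.tvec_of_components[OF C[OF c], of \<xi>] c by simp
qed

text \<open>Consistency of the components of the horizontal lift is exactly the transformation law of the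
Christoffel symbols.\<close>

lemma horizontal_lift_eq:
  assumes g: "pseudo_riemannian_metric A g" and c: "c \<in> charts_at A x"
    and u: "u \<in> tangent_space A x" and X: "X \<in> tangent_space A x"
  shows "horizontal_lift A g (x, u) X = tvec_of (tangent_atlas A) (tangent_chart A c) (x, u)
    (X c, - christoffel (form_rep A c g) (coord c x) (u c) (X c))"
  unfolding horizontal_lift_def prod.case
proof (rule tangent_lift_eq[OF u c])
  fix c c' assume cs: "c \<in> charts_at A x" "c' \<in> charts_at A x"
  have t: "v c' = dir_deriv (trans_map c c') (coord c x) (v c)" if "v \<in> tangent_space A x" for v
    using that cs unfolding tangent_space_def by blast
  show "(X c', - christoffel (form_rep A c' g) (coord c' x) (u c') (X c')) =
    (dir_deriv (trans_map c c') (coord c x) (fst (X c, - christoffel (form_rep A c g) (coord c x) (u c) (X c))),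
     dir_deriv (\<lambda>y. dir_deriv (trans_map c c') y (u c)) (coord c x)
        (fst (X c, - christoffel (form_rep A c g) (coord c x) (u c) (X c)))
     + dir_deriv (trans_map c c') (coord c x) (snd (X c, - christoffel (form_rep A c g) (coord c x) (u c) (X c))))"
    unfolding fst_conv snd_conv t[OF X] t[OF u] linear_neg[OF trans_deriv_linear[OF cs]]
      christoffel_change_chart[OF g cs]
    by simp
qed

lemma vertical_lift_eq:
  assumes c: "c \<in> charts_at A x" and u: "u \<in> tangent_space A x" and X: "X \<in> tangent_space A x"
  shows "vertical_lift A (x, u) X = tvec_of (tangent_atlas A) (tangent_chart A c) (x, u) (0, X c)"
  unfolding vertical_lift_def fst_conv
proof (rule tangent_lift_eq[OF u c])
  fix c c' assume cs: "c \<in> charts_at A x" "c' \<in> charts_at A x"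
  have t: "X c' = dir_deriv (trans_map c c') (coord c x) (X c)"
    using X cs unfolding tangent_space_def by blast
  have "trans_map c c' differentiable (at (coord c x))"
    by (rule trans_differentiable) (use cs in \<open>auto simp: charts_at_def\<close>)
  have cA: "c \<in> A" "c' \<in> A" "coord c x \<in> coord c ` (dom_of c \<inter> dom_of c')" using cs by (auto simp: charts_at_def)
  have "linear (dir_deriv (\<lambda>y. dir_deriv (trans_map c c') y (u c)) (coord c x))"
    by (rule linear_frechet_derivative[OF smooth_on_differentiable[OF smooth_on_dir_deriv[OF trans_smooth[OF cA(1,2)]] cA(3)]])
  then show "(0, X c') = (dir_deriv (trans_map c c') (coord c x) (fst (0, X c)),
     dir_deriv (\<lambda>y. dir_deriv (trans_map c c') y (u c)) (coord c x) (fst (0, X c))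
     + dir_deriv (trans_map c c') (coord c x) (snd (0, X c)))"
    unfolding t by (simp add: linear_0 linear_0[OF trans_deriv_linear[OF cs]])
qed

text \<open>Every tangent vector of the bundle is the sum of a horizontal and a vertical lift. The functions on the
half-line may be replaced by smooth extensions to the line because \<open>g(u, u) \<ge> 0\<close>.\<close>

lemma natural_metric_in_induced_chart:
  fixes F1 F2 F3 E1 E2 E3 :: "real \<Rightarrow> real"
  assumes g: "riemannian_metric A g" and G: "pseudo_riemannian_metric (tangent_atlas A) G"
    and nat: "g_natural_metric A g G \<alpha>\<^sub>1 \<alpha>\<^sub>2 \<alpha>\<^sub>3 \<beta>\<^sub>1 \<beta>\<^sub>2 \<beta>\<^sub>3" and c: "c \<in> A"
    and smooth: "\<And>f. f \<in> {F1, F2, F3, E1, E2, E3} \<Longrightarrow> smooth_on UNIV f"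
    and ext: "\<And>t. t \<ge> 0 \<Longrightarrow> \<alpha>\<^sub>1 t = F1 t" "\<And>t. t \<ge> 0 \<Longrightarrow> \<alpha>\<^sub>2 t = F2 t" "\<And>t. t \<ge> 0 \<Longrightarrow> \<alpha>\<^sub>3 t = F3 t"
      "\<And>t. t \<ge> 0 \<Longrightarrow> \<beta>\<^sub>1 t = E1 t" "\<And>t. t \<ge> 0 \<Longrightarrow> \<beta>\<^sub>2 t = E2 t" "\<And>t. t \<ge> 0 \<Longrightarrow> \<beta>\<^sub>3 t = E3 t"
  shows "natural_metric_in_chart (img_of c) (form_rep A c g) (form_rep (tangent_atlas A) (tangent_chart A c) G)
    (\<lambda>t. F1 t + F3 t) F2 F1 (\<lambda>t. E1 t + E3 t) E2 E1"
proof -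
  let ?C = "tangent_chart A c" and ?TA = "tangent_atlas A"
  let ?h = "form_rep ?TA ?C G" and ?g = "form_rep A c g"
  have pg: "pseudo_riemannian_metric A g" by (rule riemannian_imp_pseudo_riemannian[OF g])
  have C: "?C \<in> ?TA" using c by (simp add: tangent_atlas_def)
  have lg: "local_metric (img_of c) ?g" by (rule form_rep_local_metric[OF pg c])
  have lG: "local_metric (img_of c \<times> UNIV) ?h"
    using tangent.form_rep_local_metric[OF G C] by (simp add: img_tangent_chart[OF c])
  interpret lg: local_metric "img_of c" ?g by (rule lg)
  interpret lG: local_metric "img_of c \<times> UNIV" ?h by (rule lG)
  have eq: "?h (y, w) (X, W) (Y, V) = (F1 t + F3 t) * ?g y X Y + (E1 t + E3 t) * ?g y X w * ?g y Y w
        + F2 t * ?g y X L + E2 t * ?g y X w * ?g y L w + F2 t * ?g y K Y + E2 t * ?g y K w * ?g y Y w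
        + F1 t * ?g y K L + E1 t * ?g y K w * ?g y L w"
    if y: "y \<in> img_of c" and t: "t = ?g y w w" and K: "K = W + christoffel ?g y w X"
      and L: "L = V + christoffel ?g y w Y" for y w X W Y V t K L
  proof -
    define x where "x = point_at c y"
    have x: "x \<in> dom_of c" "coord c x = y" using point_at_img[OF y] by (simp_all add: x_def)
    have xp: "x \<in> points A" and cx: "c \<in> charts_at A x" using x c by (auto simp: points_def charts_at_def)
    let ?T = "tvec_of A c x"
    note T = tvec_of_in_tangent_space[OF cx]
    let ?u = "?T w"
    have p: "point_at ?C (y, w) = (x, ?u)"
      using point_at_tangent_chart[OF c y] by (simp add: x_def)
    have gT: "g x (?T P) (?T Q) = ?g y P Q" for P Q by (simp add: form_rep_def x_def)
    have t0: "0 \<le> t"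
    proof (cases "?u = (\<lambda>c. 0)")
      case True
      then have "w = 0" using tvec_of_component[OF cx, of w] by simp
      then show ?thesis using t by (simp add: lg.h_linear[OF y])
    next
      case False
      then have "g x ?u ?u > 0" using g xp T unfolding riemannian_metric_def by blast
      then show ?thesis using t gT by simp
    qed
    have hor: "tvec_of ?TA ?C (x, ?u) (P, - christoffel ?g y w P) = horizontal_lift A g (x, ?u) (?T P)" for P
      using horizontal_lift_eq[OF pg cx T T, of w P] by (simp add: tvec_of_component[OF cx] x)
    have ver: "tvec_of ?TA ?C (x, ?u) (0, P) = vertical_lift A (x, ?u) (?T P)" for P
      using vertical_lift_eq[OF cx T T, of w P] by (simp add: tvec_of_component[OF cx])
    have N: "G (x, ?u) (horizontal_lift A g (x, ?u) (?T P)) (horizontal_lift A g (x, ?u) (?T Q)) =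
          (\<alpha>\<^sub>1 t + \<alpha>\<^sub>3 t) * ?g y P Q + (\<beta>\<^sub>1 t + \<beta>\<^sub>3 t) * ?g y P w * ?g y Q w \<and>
        G (x, ?u) (horizontal_lift A g (x, ?u) (?T P)) (vertical_lift A (x, ?u) (?T Q)) =
          \<alpha>\<^sub>2 t * ?g y P Q + \<beta>\<^sub>2 t * ?g y P w * ?g y Q w \<and>
        G (x, ?u) (vertical_lift A (x, ?u) (?T P)) (horizontal_lift A g (x, ?u) (?T Q)) =
          \<alpha>\<^sub>2 t * ?g y P Q + \<beta>\<^sub>2 t * ?g y P w * ?g y Q w \<and>
        G (x, ?u) (vertical_lift A (x, ?u) (?T P)) (vertical_lift A (x, ?u) (?T Q)) =
          \<alpha>\<^sub>1 t * ?g y P Q + \<beta>\<^sub>1 t * ?g y P w * ?g y Q w" for P Q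
    proof -
      have "\<forall>x\<in>points A. \<forall>u\<in>tangent_space A x. \<forall>X\<in>tangent_space A x. \<forall>Y\<in>tangent_space A x.
         let p = (x, u); t = g x u u;
             Xh = horizontal_lift A g p X; Yh = horizontal_lift A g p Y;
             Xv = vertical_lift A p X; Yv = vertical_lift A p Y
         in G p Xh Yh = (\<alpha>\<^sub>1 t + \<alpha>\<^sub>3 t) * g x X Y + (\<beta>\<^sub>1 t + \<beta>\<^sub>3 t) * g x X u * g x Y u \<and>
            G p Xh Yv = \<alpha>\<^sub>2 t * g x X Y + \<beta>\<^sub>2 t * g x X u * g x Y u \<and>
            G p Xv Yh = \<alpha>\<^sub>2 t * g x X Y + \<beta>\<^sub>2 t * g x X u * g x Y u \<and>
            G p Xv Yv = \<alpha>\<^sub>1 t * g x X Y + \<beta>\<^sub>1 t * g x X u * g x Y u"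
        using nat unfolding g_natural_metric_def by (rule conjunct2)
      from this[rule_format, OF xp T[of w] T[of P] T[of Q]]
      show ?thesis unfolding Let_def gT t .
    qed
    have R: "?h (y, w) \<xi> \<eta> = G (x, ?u) (tvec_of ?TA ?C (x, ?u) \<xi>) (tvec_of ?TA ?C (x, ?u) \<eta>)" for \<xi> \<eta>
      by (simp add: form_rep_def p)
    have yw: "(y, w) \<in> img_of c \<times> UNIV" using y by simp
    have "?h (y, w) (X, W) (Y, V) =
        ?h (y, w) ((X, - christoffel ?g y w X) + (0, K)) ((Y, - christoffel ?g y w Y) + (0, L))"
      by (simp add: K L)
    also have "\<dots> = ?h (y, w) (X, - christoffel ?g y w X) (Y, - christoffel ?g y w Y)
        + ?h (y, w) (X, - christoffel ?g y w X) (0, L)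
        + ?h (y, w) (0, K) (Y, - christoffel ?g y w Y) + ?h (y, w) (0, K) (0, L)"
      unfolding lG.h_linear(1,2)[OF yw] by simp
    also have "\<dots> = (\<alpha>\<^sub>1 t + \<alpha>\<^sub>3 t) * ?g y X Y + (\<beta>\<^sub>1 t + \<beta>\<^sub>3 t) * ?g y X w * ?g y Y w
        + (\<alpha>\<^sub>2 t * ?g y X L + \<beta>\<^sub>2 t * ?g y X w * ?g y L w)
        + (\<alpha>\<^sub>2 t * ?g y K Y + \<beta>\<^sub>2 t * ?g y K w * ?g y Y w)
        + (\<alpha>\<^sub>1 t * ?g y K L + \<beta>\<^sub>1 t * ?g y K w * ?g y L w)"
      unfolding R hor ver using N by simp
    finally show ?thesis by (simp add: ext t0)
  qed
  have smooth_coeffs: "smooth_on UNIV f"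
    if "f \<in> {\<lambda>t. F1 t + F3 t, F2, F1, \<lambda>t. E1 t + E3 t, E2, E1}" for f
  proof -
    have "smooth_on UNIV (\<lambda>t. F1 t + F3 t)" "smooth_on UNIV (\<lambda>t. E1 t + E3 t)"
      by (intro smooth_on_add open_UNIV smooth; simp)+
    then show ?thesis using that smooth by auto
  qed
  show ?thesis
    by (intro natural_metric_in_chart.intro natural_metric_in_chart_axioms.intro lg lG smooth_coeffs eq)
qed

end

section \<open>Ricci solitons\<close>

theorem theorem2:
  fixes A :: "('m, 'e::euclidean_space) chart set"
    and g :: "('m, 'e) bilinear_field"
    and G :: "(('m, 'e) tpoint, 'e \<times> 'e) bilinear_field"
    and \<alpha>\<^sub>1 \<alpha>\<^sub>2 \<alpha>\<^sub>3 \<beta>\<^sub>1 \<beta>\<^sub>2 \<beta>\<^sub>3 :: "real \<Rightarrow> real"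
    and Z :: "(('m, 'e) tpoint, 'e \<times> 'e) vfield"
    and lambda_bar :: real
  assumes "smooth_manifold A"
    and "DIM('e) \<ge> 3"
    and "riemannian_metric A g"
    and "pseudo_riemannian_metric (tangent_atlas A) G"
    and "g_natural_metric A g G \<alpha>\<^sub>1 \<alpha>\<^sub>2 \<alpha>\<^sub>3 \<beta>\<^sub>1 \<beta>\<^sub>2 \<beta>\<^sub>3"
    and "\<alpha>\<^sub>1 0 * (\<alpha>\<^sub>1 0 + \<alpha>\<^sub>3 0) - 2 * (\<alpha>\<^sub>2 0)\<^sup>2 \<noteq> 0"
    and "vector_field (tangent_atlas A) Z"
    and "ricci_soliton (tangent_atlas A) G Z lambda_bar"
  shows "ricci_soliton A g
    (\<lambda>x c. (alpha_fun \<alpha>\<^sub>1 \<alpha>\<^sub>2 \<alpha>\<^sub>3 0 / (\<alpha>\<^sub>1 0 * (\<alpha>\<^sub>1 0 + \<alpha>\<^sub>3 0) - 2 * (\<alpha>\<^sub>2 0)\<^sup>2)) *\<^sub>R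
       ((\<alpha>\<^sub>1 0 + \<alpha>\<^sub>3 0) *\<^sub>R dproj A (zero_vector x) (Z (zero_vector x)) c
        + \<alpha>\<^sub>2 0 *\<^sub>R connection_map A g (zero_vector x) (Z (zero_vector x)) c))
    ((\<alpha>\<^sub>1 0 + \<alpha>\<^sub>3 0) *
       (lambda_bar * alpha_fun \<alpha>\<^sub>1 \<alpha>\<^sub>2 \<alpha>\<^sub>3 0 + \<beta>\<^sub>1 0 + \<beta>\<^sub>3 0
        + real DIM('e) * half_line_deriv (\<lambda>t. \<alpha>\<^sub>1 t + \<alpha>\<^sub>3 t) 0) /
     (\<alpha>\<^sub>1 0 * (\<alpha>\<^sub>1 0 + \<alpha>\<^sub>3 0) - 2 * (\<alpha>\<^sub>2 0)\<^sup>2))"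
proof -
  define a0 b0 where "a0 = \<alpha>\<^sub>1 0 + \<alpha>\<^sub>3 0" and "b0 = \<alpha>\<^sub>2 0"
  define D where "D = \<alpha>\<^sub>1 0 * (\<alpha>\<^sub>1 0 + \<alpha>\<^sub>3 0) - 2 * (\<alpha>\<^sub>2 0)\<^sup>2"
  define \<mu> where "\<mu> = alpha_fun \<alpha>\<^sub>1 \<alpha>\<^sub>2 \<alpha>\<^sub>3 0 / D"
  define Z0 where "Z0 x c = \<mu> *\<^sub>R (a0 *\<^sub>R dproj A (zero_vector x) (Z (zero_vector x)) c
      + b0 *\<^sub>R connection_map A g (zero_vector x) (Z (zero_vector x)) c)" for x c
  have atlas: "smooth_atlas A" using assms(1) by (simp add: smooth_manifold_def)
  interpret differentiable_atlas A by (rule smooth_atlas_differentiable[OF atlas])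
  interpret base_atlas A by unfold_locales (rule atlas)
  have pg: "pseudo_riemannian_metric A g" by (rule riemannian_imp_pseudo_riemannian[OF assms(3)])
  have sm: "\<forall>f\<in>{\<alpha>\<^sub>1, \<alpha>\<^sub>2, \<alpha>\<^sub>3, \<beta>\<^sub>1, \<beta>\<^sub>2, \<beta>\<^sub>3}. smooth_half_line f"
    using assms(5) unfolding g_natural_metric_def by (rule conjunct1)
  (* The functions on the half-line are replaced by smooth extensions to the line. *)
  obtain F1 where F1: "smooth_on UNIV F1" "\<And>t. t \<ge> 0 \<Longrightarrow> \<alpha>\<^sub>1 t = F1 t"
    using sm unfolding smooth_half_line_def by blast
  obtain F2 where F2: "smooth_on UNIV F2" "\<And>t. t \<ge> 0 \<Longrightarrow> \<alpha>\<^sub>2 t = F2 t"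
    using sm unfolding smooth_half_line_def by blast
  obtain F3 where F3: "smooth_on UNIV F3" "\<And>t. t \<ge> 0 \<Longrightarrow> \<alpha>\<^sub>3 t = F3 t"
    using sm unfolding smooth_half_line_def by blast
  obtain E1 where E1: "smooth_on UNIV E1" "\<And>t. t \<ge> 0 \<Longrightarrow> \<beta>\<^sub>1 t = E1 t"
    using sm unfolding smooth_half_line_def by blast
  obtain E2 where E2: "smooth_on UNIV E2" "\<And>t. t \<ge> 0 \<Longrightarrow> \<beta>\<^sub>2 t = E2 t"
    using sm unfolding smooth_half_line_def by blast
  obtain E3 where E3: "smooth_on UNIV E3" "\<And>t. t \<ge> 0 \<Longrightarrow> \<beta>\<^sub>3 t = E3 t"
    using sm unfolding smooth_half_line_def by blast
  have nat: "natural_metric_in_chart (img_of c) (form_rep A c g) (form_rep (tangent_atlas A) (tangent_chart A c) G)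
      (\<lambda>t. F1 t + F3 t) F2 F1 (\<lambda>t. E1 t + E3 t) E2 E1" if "c \<in> A" for c
    by (rule natural_metric_in_induced_chart[OF assms(3,4,5) that _ F1(2) F2(2) F3(2) E1(2) E2(2) E3(2)])
      (use F1(1) F2(1) F3(1) E1(1) E2(1) E3(1) in auto)
  have deriv: "half_line_deriv (\<lambda>t. \<alpha>\<^sub>1 t + \<alpha>\<^sub>3 t) 0 = deriv (\<lambda>t. F1 t + F3 t) 0"
    by (rule half_line_deriv_eq[OF smooth_on_add[OF open_UNIV F1(1) F3(1)]]) (simp add: F1(2) F3(2))
  (* At a zero vector the Christoffel term of the connection map vanishes. *)
  have conn: "connection_map A g (zero_vector x) \<xi> c = snd (\<xi> (tangent_chart A c))"
    and proj: "dproj A (zero_vector x) \<xi> c = fst (\<xi> (tangent_chart A c))"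
    if c: "c \<in> charts_at A x" for c x \<xi>
  proof -
    have "c \<in> A" "coord c x \<in> img_of c" using c by (auto simp: charts_at_def img_of_def)
    then interpret local_metric "img_of c" "form_rep A c g"
      by (intro form_rep_local_metric[OF pg])
    show "connection_map A g (zero_vector x) \<xi> c = snd (\<xi> (tangent_chart A c))"
      using c by (simp add: connection_map_def zero_vector_def christoffel_linear[OF \<open>coord c x \<in> img_of c\<close>])
    show "dproj A (zero_vector x) \<xi> c = fst (\<xi> (tangent_chart A c))"
      using c by (simp add: dproj_def zero_vector_def)
  qed
  have Z0_at: "Z0 x c = \<mu> *\<^sub>R (a0 *\<^sub>R fst (Z (zero_vector x) (tangent_chart A c))
      + b0 *\<^sub>R snd (Z (zero_vector x) (tangent_chart A c)))" if "c \<in> charts_at A x" for x c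
    by (simp add: Z0_def conn[OF that] proj[OF that])
  have Z0_tangent: "Z0 x \<in> tangent_space A x" if x: "x \<in> points A" for x
  proof -
    obtain d where "d \<in> charts_at A x" using x by (auto simp: points_def charts_at_def)
    then have "tangent_chart A d \<in> charts_at (tangent_atlas A) (zero_vector x)"
      by (simp add: zero_vector_def charts_at_tangent[OF zero_tangent])
    then have "zero_vector x \<in> points (tangent_atlas A)"
      by (auto simp: points_def charts_at_def)
    then have Z: "Z (zero_vector x) \<in> tangent_space (tangent_atlas A) (zero_vector x)"
      using assms(7) by (simp add: vector_field_def)
    have out: "Z0 x c = 0" if "c \<notin> charts_at A x" for c
      using that by (simp add: Z0_def dproj_def connection_map_def zero_vector_def)
    have "Z0 x c' = dir_deriv (trans_map c c') (coord c x) (Z0 x c)"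
      if c: "c \<in> charts_at A x" "c' \<in> charts_at A x" for c c'
      unfolding Z0_at[OF c(1)] Z0_at[OF c(2)] tangent_vector_at_zero_change[OF Z c]
      by (simp add: linear_add[OF trans_deriv_linear[OF c]] linear_scale[OF trans_deriv_linear[OF c]])
    then show ?thesis using out unfolding tangent_space_def by blast
  qed
  have Z0_rep: "vfield_rep c Z0 y = \<mu> *\<^sub>R (a0 *\<^sub>R fst (vfield_rep (tangent_chart A c) Z (y, 0))
      + b0 *\<^sub>R snd (vfield_rep (tangent_chart A c) Z (y, 0)))" if c: "c \<in> A" and y: "y \<in> img_of c" for c y
  proof -
    have x: "c \<in> charts_at A (point_at c y)" using point_at_img[OF y] c by (simp add: charts_at_def)
    have "point_at (tangent_chart A c) (y, 0) = zero_vector (point_at c y)"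
      by (simp add: point_at_tangent_chart[OF c y] tvec_of_0[OF x] zero_vector_def)
    then show ?thesis by (simp add: vfield_rep_def Z0_at[OF x])
  qed
  have Z_smooth: "smooth_on (img_of c \<times> UNIV) (vfield_rep (tangent_chart A c) Z)" if c: "c \<in> A" for c
    using assms(7) c unfolding vector_field_def tangent_atlas_def by (auto simp: img_tangent_chart)
  have Z0_smooth: "smooth_on (img_of c) (vfield_rep c Z0)" if c: "c \<in> A" for c
    unfolding smooth_on_def
  proof
    fix k
    have "bounded_linear (\<lambda>v :: 'e \<times> 'e. \<mu> *\<^sub>R (a0 *\<^sub>R fst v + b0 *\<^sub>R snd v))"
      by (intro bounded_linear_scaleR_right[THEN bounded_linear_compose] bounded_linear_add
          bounded_linear_fst bounded_linear_snd)
    from C_on_linear_slice[OF chart_open[OF c] this, of k "vfield_rep (tangent_chart A c) Z"]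
    show "C_on k (img_of c) (vfield_rep c Z0)"
      using Z_smooth[OF c] Z0_rep[OF c] C_on_cong_open[OF chart_open[OF c], of "vfield_rep c Z0"]
      unfolding smooth_on_def by simp
  qed
  have eq: "ricci (form_rep A c g) y X Y + 1 / 2 * lie_derivative (vfield_rep c Z0) (form_rep A c g) y X Y
      = a0 * (lambda_bar * alpha_fun \<alpha>\<^sub>1 \<alpha>\<^sub>2 \<alpha>\<^sub>3 0 + \<beta>\<^sub>1 0 + \<beta>\<^sub>3 0
        + real DIM('e) * half_line_deriv (\<lambda>t. \<alpha>\<^sub>1 t + \<alpha>\<^sub>3 t) 0) / D * form_rep A c g y X Y"
    if c: "c \<in> A" and y: "y \<in> img_of c" for c y X Y
  proof -
    let ?V = "vfield_rep (tangent_chart A c) Z"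
    interpret N: natural_metric_in_chart "img_of c" "form_rep A c g" "form_rep (tangent_atlas A) (tangent_chart A c) G"
      "\<lambda>t. F1 t + F3 t" F2 F1 "\<lambda>t. E1 t + E3 t" E2 E1 by (rule nat[OF c])
    have V: "?V differentiable (at (y, 0))"
      by (rule smooth_on_differentiable[OF Z_smooth[OF c]]) (simp add: y)
    have D': "D = (F1 0 + F3 0) * F1 0 - 2 * (F2 0)\<^sup>2"
      by (simp add: D_def F1(2) F2(2) F3(2) mult.commute)
    have \<alpha>: "N.\<alpha> = alpha_fun \<alpha>\<^sub>1 \<alpha>\<^sub>2 \<alpha>\<^sub>3 0"
      by (simp add: N.\<alpha>_def alpha_fun_def F1(2) F2(2) F3(2) mult.commute)
    have D0: "D \<noteq> 0" using assms(6) by (simp add: D_def)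
    have sol: "ricci (form_rep (tangent_atlas A) (tangent_chart A c) G) (y, 0) (X, 0) (Y, 0)
        + 1 / 2 * lie_derivative ?V (form_rep (tangent_atlas A) (tangent_chart A c) G) (y, 0) (X, 0) (Y, 0)
        = lambda_bar * form_rep (tangent_atlas A) (tangent_chart A c) G (y, 0) (X, 0) (Y, 0)"
      using assms(8) c y unfolding ricci_soliton_def tangent_atlas_def by (simp add: img_tangent_chart)
    have lie: "lie_derivative (vfield_rep c Z0) (form_rep A c g) y X Y =
        lie_derivative (\<lambda>y. (N.\<alpha> / D) *\<^sub>R ((F1 0 + F3 0) *\<^sub>R fst (?V (y, 0)) + F2 0 *\<^sub>R snd (?V (y, 0))))
          (form_rep A c g) y X Y"
    proof -
      have e: "vfield_rep c Z0 y = (N.\<alpha> / D) *\<^sub>R ((F1 0 + F3 0) *\<^sub>R fst (?V (y, 0)) + F2 0 *\<^sub>R snd (?V (y, 0)))"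
        if "y \<in> img_of c" for y
        using Z0_rep[OF c that] by (simp add: \<alpha> \<mu>_def a0_def b0_def F1(2) F2(2) F3(2))
      note dir_deriv_cong_open[OF chart_open[OF c] y e]
      then show ?thesis
        unfolding lie_derivative_def e[OF y] by (simp only:)
    qed
    show ?thesis
      unfolding lie N.soliton_zero_section[OF y V D' D0 sol]
      unfolding \<alpha> deriv by (simp add: a0_def F1(2) F3(2) E1(2) E3(2) add.assoc)
  qed
  have "ricci_soliton A g Z0 (a0 * (lambda_bar * alpha_fun \<alpha>\<^sub>1 \<alpha>\<^sub>2 \<alpha>\<^sub>3 0 + \<beta>\<^sub>1 0 + \<beta>\<^sub>3 0
        + real DIM('e) * half_line_deriv (\<lambda>t. \<alpha>\<^sub>1 t + \<alpha>\<^sub>3 t) 0) / D)"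
    using pg Z0_tangent Z0_smooth eq unfolding ricci_soliton_def vector_field_def by blast
  then show ?thesis
    unfolding Z0_def[abs_def] \<mu>_def D_def a0_def b0_def .
qed

end
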